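(* Let $\Omega\subseteq\mathbb{R}^N$ be a bounded domain with boundary of class $C^2$, let $\sigma\in(0,1)$ and $p\in[1,\infty)$. Let $g\in C^0(\partial\Omega)$ and $h\in L^\infty(\mathbb{R}^N\setminus\overline{\Omega})$ be such that $g\not\le0$ on $\partial\Omega$ (that is, $g$ is positive at some point of $\partial\Omega$) and $h\le0$ in $\mathbb{R}^N\setminus\overline{\Omega}$. If $\sigma p\ge1$, then the problem $$\begin{cases}-\Delta u+\big|(-\Delta)^\sigma u\big|^{p-1}(-\Delta)^\sigma u=0&\text{in }\Omega,\\ u=g&\text{on }\partial\Omega,\\ u=h&\text{in }\mathbb{R}^N\setminus\overline{\Omega}\end{cases}$$ has no solution $u\in L^\infty(\mathbb{R}^N)\cap C^2(\Omega)\cap C^0(\overline{\Omega})$.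
   Context: $\Delta$ is the classical Laplacian and $(-\Delta)^\sigma$ is the fractional Laplacian, defined pointwise by $$(-\Delta)^\sigma u(x):=c_{N,\sigma}\lim_{\varepsilon\downarrow0}\int_{\mathbb{R}^N\setminus B_\varepsilon(x)}\frac{u(x)-u(y)}{|x-y|^{N+2\sigma}}\,dy,$$ where $c_{N,\sigma}>0$ is the normalizing constant for which the Fourier symbol of $(-\Delta)^\sigma$ is $|\xi|^{2\sigma}$. The equation in $\Omega$ is understood pointwise. $u\in C^0(\overline\Omega)$ means that $u|_{\overline\Omega}$ is continuous (no continuity across $\partial\Omega$ from the exterior is required). *)

theory Defs
  imports "HOL-Analysis.Analysis"
begin

text \<open>
  The ambient space \<open>\<real>\<^sup>N\<close> is an arbitrary type of class \<open>euclidean_space\<close>, with \<open>N = DIM('a)\<close>.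
\<close>

text \<open>Meant for open \<open>S\<close>: \<open>G\<close> is the gradient and \<open>H\<close> the Hessian of \<open>u\<close>.\<close>

definition C2_on :: "'a::euclidean_space set \<Rightarrow> ('a \<Rightarrow> real) \<Rightarrow> bool" where
  "C2_on S u \<longleftrightarrow>
     (\<exists>(G :: 'a \<Rightarrow> 'a) (H :: 'a \<Rightarrow> 'a \<Rightarrow>\<^sub>L 'a).
        (\<forall>x\<in>S. (u has_derivative (\<lambda>v. G x \<bullet> v)) (at x)) \<and>
        (\<forall>x\<in>S. (G has_derivative blinfun_apply (H x)) (at x)) \<and>
        continuous_on S H)"

text \<open>
  Near each boundary point, \<open>\<Omega>\<close> is the strict epigraph, in some direction \<open>\<nu>\<close>, of a \<open>C\<^sup>2\<close> function
  on the hyperplane orthogonal to \<open>\<nu>\<close>. The function \<open>\<gamma>\<close> is defined on the whole space, but only its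
  values on that hyperplane are used (for \<open>N = 1\<close> only \<open>\<gamma> 0\<close>).
\<close>

definition C2_boundary :: "'a::euclidean_space set \<Rightarrow> bool" where
  "C2_boundary \<Omega> \<longleftrightarrow>
     (\<forall>x0\<in>frontier \<Omega>. \<exists>r>0. \<exists>\<nu> \<gamma>. norm \<nu> = 1 \<and> C2_on UNIV \<gamma> \<and>
        (\<forall>x\<in>ball x0 r. x \<in> \<Omega> \<longleftrightarrow> x \<bullet> \<nu> > \<gamma> (x - (x \<bullet> \<nu>) *\<^sub>R \<nu>)))"

definition bounded_C2_domain :: "'a::euclidean_space set \<Rightarrow> bool" where
  "bounded_C2_domain \<Omega> \<longleftrightarrow>
     open \<Omega> \<and> connected \<Omega> \<and> \<Omega> \<noteq> {} \<and> bounded \<Omega> \<and> C2_boundary \<Omega>"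

definition Linfty_on :: "'a::euclidean_space set \<Rightarrow> ('a \<Rightarrow> real) \<Rightarrow> bool" where
  "Linfty_on S f \<longleftrightarrow>
     f \<in> borel_measurable (lebesgue_on S) \<and> (\<exists>C. AE x in lebesgue_on S. \<bar>f x\<bar> \<le> C)"

definition laplacian :: "('a::euclidean_space \<Rightarrow> real) \<Rightarrow> 'a \<Rightarrow> real" where
  "laplacian u x = (\<Sum>b\<in>Basis. deriv (deriv (\<lambda>t. u (x + t *\<^sub>R b))) 0)"

text \<open>
  The truncated singular integral, for vector-valued \<open>u\<close> so that it can be applied to plane waves.
\<close>

definition frac_lap_trunc ::
  "real \<Rightarrow> ('a::euclidean_space \<Rightarrow> 'b::{banach, second_countable_topology}) \<Rightarrow> 'a \<Rightarrow> real \<Rightarrow> 'b" where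
  "frac_lap_trunc \<sigma> u x \<epsilon> =
     (LINT y:(- ball x \<epsilon>)|lebesgue. (u x - u y) /\<^sub>R norm (x - y) powr (real DIM('a) + 2 * \<sigma>))"

text \<open>
  The constant \<open>c\<^bsub>N,\<sigma>\<^esub>\<close>: having Fourier symbol \<open>m(\<xi>)\<close> means that the operator maps every plane wave
  \<open>y \<mapsto> exp(\<i> \<xi> \<bullet> y)\<close> to \<open>m(\<xi>)\<close> times itself; here \<open>m(\<xi>) = |\<xi>|\<^bsup>2\<sigma>\<^esup>\<close>.
\<close>

definition frac_lap_const :: "'a::euclidean_space itself \<Rightarrow> real \<Rightarrow> real" where
  "frac_lap_const _ \<sigma> =
     (THE c. 0 < c \<and>
        (\<forall>\<xi> x :: 'a.
           ((\<lambda>\<epsilon>. c *\<^sub>R frac_lap_trunc \<sigma> (\<lambda>y. cis (\<xi> \<bullet> y)) x \<epsilon>)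
              \<longlongrightarrow> norm \<xi> powr (2 * \<sigma>) *\<^sub>R cis (\<xi> \<bullet> x)) (at_right 0)))"

text \<open>
  \<open>has_frac_laplacian \<sigma> u x l\<close>: the limit defining \<open>(-\<Delta>)\<^sup>\<sigma> u(x)\<close> exists and equals \<open>l\<close>.
\<close>

definition has_frac_laplacian :: "real \<Rightarrow> ('a::euclidean_space \<Rightarrow> real) \<Rightarrow> 'a \<Rightarrow> real \<Rightarrow> bool" where
  "has_frac_laplacian \<sigma> u x l \<longleftrightarrow>
     ((\<lambda>\<epsilon>. frac_lap_const TYPE('a) \<sigma> * frac_lap_trunc \<sigma> u x \<epsilon>) \<longlongrightarrow> l) (at_right 0)"

text \<open>
  The exterior datum \<open>h\<close> is an \<open>L\<^sup>\<infinity>\<close> class, so the exterior condition holds almost everywhere; the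
  equation and the boundary condition hold at every point. For \<open>p = 1\<close>, \<open>l = 0\<close> the convention
  \<open>0 powr 0 = 0\<close> is harmless because of the factor \<open>l\<close>.
\<close>

definition solves_mixed_problem ::
  "'a::euclidean_space set \<Rightarrow> real \<Rightarrow> real \<Rightarrow> ('a \<Rightarrow> real) \<Rightarrow> ('a \<Rightarrow> real) \<Rightarrow> ('a \<Rightarrow> real) \<Rightarrow> bool" where
  "solves_mixed_problem \<Omega> \<sigma> p g h u \<longleftrightarrow>
     (\<forall>x\<in>\<Omega>. \<exists>l. has_frac_laplacian \<sigma> u x l \<and> - laplacian u x + \<bar>l\<bar> powr (p - 1) * l = 0) \<and>
     (\<forall>x\<in>frontier \<Omega>. u x = g x) \<and>
     (AE x in lebesgue_on (- closure \<Omega>). u x = h x)"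

end

theory Submission
  imports Defs
begin

text \<open>
  A solution \<open>u\<close> has a positive maximum \<open>M\<close> over the closure of \<open>\<Omega>\<close>. It is not attained in \<open>\<Omega>\<close>: there
  \<open>\<Delta>u \<le> 0\<close> and \<open>(-\<Delta>)\<^sup>\<sigma>u > 0\<close>, because \<open>u \<le> 0 < M\<close> outside. So it is attained at some \<open>x0\<close> on the
  boundary, near which \<open>\<Omega> = {\<rho> > 0}\<close> with \<open>\<rho>\<close> of class \<open>C\<^sup>2\<close> and comparable to the distance to the
  boundary. Let \<open>x\<close> maximise \<open>u + \<epsilon> ln \<rho> - |y - x0|\<^sup>2\<close> near \<open>x0\<close>; for small \<open>\<epsilon>\<close> it is an interior point
  close to \<open>x0\<close> with \<open>u x\<close> close to \<open>M\<close>. Touching by the penalty gives \<open>\<Delta>u \<le> C (\<epsilon> \<rho>\<^sup>-\<^sup>2 + 1)\<close> at \<open>x\<close>,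
  while the jump of \<open>u\<close> across the boundary, at distance about \<open>\<rho>\<close>, gives
  \<open>(-\<Delta>)\<^sup>\<sigma>u \<ge> c \<rho> powr (- 2\<sigma>)\<close>. The equation then yields \<open>c powr p \<cdot> \<rho> powr (- 2\<sigma>p) \<le> C (\<epsilon> \<rho>\<^sup>-\<^sup>2 + 1)\<close>, which is
  impossible for small \<open>\<epsilon>\<close> and \<open>\<rho>\<close> when \<open>2\<sigma>p \<ge> 2\<close>.
\<close>

section \<open>Invariance of Lebesgue measure\<close>

lemma nn_integral_lborel_translation:
  fixes c :: "'a::euclidean_space" and f :: "'a \<Rightarrow> ennreal"
  assumes [measurable]: "f \<in> borel_measurable borel"
  shows "(\<integral>\<^sup>+x. f (c + x) \<partial>lborel) = (\<integral>\<^sup>+x. f x \<partial>lborel)"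
  by (subst (2) lborel_distr_plus[of c, symmetric], subst nn_integral_distr) auto

text \<open>
  Uniqueness of translation-invariant measures by Fubini: for \<open>f\<close> the indicator of the unit ball,
  \<open>\<integral>\<integral> f(x) g(x + T y)\<close> computed in the two orders gives \<open>|B| \<integral>g \<circ> T\<close> and
  \<open>|T\<inverse>B| \<integral>g\<close>, and \<open>T\<inverse>B = B\<close>.
\<close>

lemma distr_lborel_orthogonal:
  fixes T :: "'a::euclidean_space \<Rightarrow> 'a"
  assumes T: "orthogonal_transformation T"
  shows "distr lborel borel T = lborel"
proof (rule measure_eqI)
  have lin: "linear T" and norm_T: "\<And>x. norm (T x) = norm x"
    using T by (auto simp: orthogonal_transformation)
  have [measurable]: "T \<in> borel_measurable borel"
    using lin by (intro borel_measurable_continuous_onI linear_continuous_on)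
      (simp add: linear_conv_bounded_linear)
  show "sets (distr lborel borel T) = sets lborel" by simp
  fix A assume "A \<in> sets (distr lborel borel T)"
  then have [measurable]: "A \<in> sets borel" by simp
  define g :: "'a \<Rightarrow> ennreal" where "g = indicator A"
  have [measurable]: "g \<in> borel_measurable borel" by (simp add: g_def)
  define f :: "'a \<Rightarrow> ennreal" where "f = indicator (ball 0 1)"
  have [measurable]: "f \<in> borel_measurable borel" by (auto simp: f_def intro!: borel_measurable_indicator)
  define V where "V = emeasure lborel (ball (0::'a) 1)"
  have fV: "(\<integral>\<^sup>+x. f x \<partial>lborel) = V" by (simp add: f_def V_def)
  \<comment> \<open>Since \<open>T\<close> is linear and onto, shifting the value \<open>T y\<close>
    by \<open>x\<close> amounts to shifting \<open>y\<close> by a preimage of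
    \<open>x\<close>.\<close>
  have shift: "(\<integral>\<^sup>+y. g (x + T y) \<partial>lborel) = (\<integral>\<^sup>+y. g (T y) \<partial>lborel)" for x
  proof -
    obtain w where w: "T w = x" using orthogonal_transformation_surj[OF T] by (metis surjD)
    have "x + T y = T (w + y)" for y using w lin by (simp add: linear_add)
    then show ?thesis
      using nn_integral_lborel_translation[of "\<lambda>y. g (T y)" w] by simp
  qed
  \<comment> \<open>\<open>T\<close> is an isometry, so the \<open>y\<close> with \<open>T y\<close>
    within 1 of \<open>x\<close> form the unit ball about the preimage \<open>w\<close>.\<close>
  have ball_vol: "(\<integral>\<^sup>+y. f (x - T y) \<partial>lborel) = V" for x
  proof -
    obtain w where w: "T w = x" using orthogonal_transformation_surj[OF T] by (metis surjD)
    have "norm (x - T y) = norm (w - y)" for y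
      using w lin norm_T by (metis linear_diff)
    then have "f (x - T y) = indicator (ball w 1) y" for y
      by (simp add: f_def indicator_def dist_norm norm_minus_commute[of "T y" x])
    then have "(\<integral>\<^sup>+y. f (x - T y) \<partial>lborel) = emeasure lborel (ball w 1)" by simp
    then show ?thesis by (simp add: V_def emeasure_ball)
  qed
  have "V * (\<integral>\<^sup>+y. g (T y) \<partial>lborel) = (\<integral>\<^sup>+x. f x * (\<integral>\<^sup>+y. g (T y) \<partial>lborel) \<partial>lborel)"
    by (subst nn_integral_multc) (simp_all add: fV)
  also have "\<dots> = (\<integral>\<^sup>+x. \<integral>\<^sup>+y. f x * g (x + T y) \<partial>lborel \<partial>lborel)"
    by (intro nn_integral_cong) (subst nn_integral_cmult, auto simp: shift)
  also have "\<dots> = (\<integral>\<^sup>+y. \<integral>\<^sup>+x. f x * g (x + T y) \<partial>lborel \<partial>lborel)"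
    by (rule lborel_pair.Fubini') auto
  also have "\<dots> = (\<integral>\<^sup>+y. \<integral>\<^sup>+x. f (x - T y) * g x \<partial>lborel \<partial>lborel)"
  proof (rule nn_integral_cong)
    fix y
    show "(\<integral>\<^sup>+x. f x * g (x + T y) \<partial>lborel) = (\<integral>\<^sup>+x. f (x - T y) * g x \<partial>lborel)"
      using nn_integral_lborel_translation[of "\<lambda>x. f (x - T y) * g x" "T y"]
      by (simp add: add.commute)
  qed
  also have "\<dots> = (\<integral>\<^sup>+x. \<integral>\<^sup>+y. f (x - T y) * g x \<partial>lborel \<partial>lborel)"
    by (rule lborel_pair.Fubini') auto
  also have "\<dots> = (\<integral>\<^sup>+x. V * g x \<partial>lborel)"
    by (intro nn_integral_cong) (subst nn_integral_multc, auto simp: ball_vol)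
  also have "\<dots> = V * (\<integral>\<^sup>+x. g x \<partial>lborel)"
    by (subst nn_integral_cmult) auto
  finally have "V * (\<integral>\<^sup>+y. g (T y) \<partial>lborel) = V * (\<integral>\<^sup>+x. g x \<partial>lborel)" .
  \<comment> \<open>In \<open>ennreal\<close> the common factor cancels only if it is nonzero and
    finite.\<close>
  moreover have "V \<noteq> 0" "V \<noteq> \<infinity>"
    using unit_ball_vol_pos[of "real DIM('a)"]
    by (auto simp: V_def emeasure_ball simp del: unit_ball_vol_pos)
  ultimately have "(\<integral>\<^sup>+y. g (T y) \<partial>lborel) = (\<integral>\<^sup>+x. g x \<partial>lborel)"
    by (simp add: ennreal_mult_cancel_left)
  moreover have "g (T y) = indicator (T -` A) y" for y by (simp add: g_def indicator_def)
  moreover have "T -` A \<in> sets lborel" using measurable_sets[of T borel borel A] by simp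
  ultimately show "emeasure (distr lborel borel T) A = emeasure lborel A"
    by (simp add: emeasure_distr g_def)
qed

lemma integral_lborel_orthogonal:
  fixes T :: "'a::euclidean_space \<Rightarrow> 'a" and f :: "'a \<Rightarrow> 'b::{banach, second_countable_topology}"
  assumes T: "orthogonal_transformation T" and [measurable]: "f \<in> borel_measurable borel"
  shows "(\<integral>x. f (T x) \<partial>lborel) = (\<integral>x. f x \<partial>lborel)"
proof -
  have "linear T" using T by (auto simp: orthogonal_transformation)
  then have [measurable]: "T \<in> borel_measurable borel"
    by (intro borel_measurable_continuous_onI linear_continuous_on)
      (simp add: linear_conv_bounded_linear)
  show ?thesis
    by (subst (2) distr_lborel_orthogonal[OF T, symmetric], subst integral_distr) auto
qed

lemma integral_lborel_uminus:
  fixes f :: "'a::euclidean_space \<Rightarrow> 'b::{banach, second_countable_topology}"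
  assumes "f \<in> borel_measurable borel"
  shows "(\<integral>x. f (- x) \<partial>lborel) = (\<integral>x. f x \<partial>lborel)"
  by (rule integral_lborel_orthogonal[OF _ assms]) (simp add: orthogonal_transformation_neg)

lemma integral_lborel_scaleR:
  fixes f :: "'a::euclidean_space \<Rightarrow> real"
  assumes [measurable]: "f \<in> borel_measurable borel" and "c > 0"
  shows "(\<integral>x. f x \<partial>lborel) = c ^ DIM('a) * (\<integral>x. f (c *\<^sub>R x) \<partial>lborel)"
proof -
  have "(\<integral>x. f x \<partial>lborel)
      = (\<integral>x. f x \<partial>density (distr lborel borel (\<lambda>x. 0 + c *\<^sub>R x)) (\<lambda>_. ennreal (\<bar>c\<bar> ^ DIM('a))))"
    using lborel_affine[of c "0::'a"] \<open>c > 0\<close> by simp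
  also have "\<dots> = (\<integral>x. c ^ DIM('a) *\<^sub>R f (c *\<^sub>R x) \<partial>lborel)"
    using \<open>c > 0\<close> by (subst integral_density) (auto simp: integral_distr)
  finally show ?thesis by simp
qed

lemma integral_lborel_translation:
  fixes f :: "'a::euclidean_space \<Rightarrow> 'b::{banach, second_countable_topology}"
  assumes [measurable]: "f \<in> borel_measurable borel"
  shows "(\<integral>x. f (c + x) \<partial>lborel) = (\<integral>x. f x \<partial>lborel)"
  by (subst (2) lborel_distr_plus[of c, symmetric], subst integral_distr) auto

text \<open>Reflect in the hyperplane orthogonal to \<open>v = a - b\<close>. Equal norms give
  \<open>2 * (a \<bullet> v) = v \<bullet> v\<close>, so the reflection subtracts exactly
  \<open>v\<close> from \<open>a\<close>.\<close>

lemma householder_reflection: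
  fixes a b :: "'a::euclidean_space"
  assumes "norm a = norm b"
  obtains T where "orthogonal_transformation T" "T a = b"
proof (cases "a = b")
  case True
  then show thesis using that[of "\<lambda>x. x"] by simp
next
  case False
  define v where "v = a - b"
  define T where "T x = x - (2 * (x \<bullet> v) / (v \<bullet> v)) *\<^sub>R v" for x
  have vv: "v \<bullet> v > 0" using False by (simp add: v_def)
  have "linear T"
    by (rule linearI) (simp_all add: T_def inner_add_left algebra_simps add_divide_distrib)
  moreover have "T x \<bullet> T x = x \<bullet> x" for x
    using vv by (simp add: T_def inner_diff_left inner_diff_right inner_commute field_simps)
  then have "norm (T x) = norm x" for x by (simp add: norm_eq_sqrt_inner)
  ultimately have "orthogonal_transformation T" by (simp add: orthogonal_transformation)
  moreover have "T a = b"
  proof -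
    have "a \<bullet> a = b \<bullet> b" using assms by (simp add: norm_eq_sqrt_inner)
    then have "2 * (a \<bullet> v) = v \<bullet> v"
      by (simp add: v_def inner_diff_left inner_diff_right inner_commute)
    then show ?thesis using vv by (simp add: T_def) (simp add: v_def)
  qed
  ultimately show thesis using that by blast
qed

section \<open>The kernel of the fractional Laplacian\<close>

text \<open>The kernel of the singular integral. The conventions \<open>0 powr d = 0\<close> and
  \<open>inverse 0 = 0\<close> make it vanish at the origin, so positivity and lower bounds require
  \<open>z \<noteq> 0\<close>, while upper bounds on \<open>norm z\<close> alone do not control
  it.\<close>

definition riesz_weight :: "real \<Rightarrow> 'a::euclidean_space \<Rightarrow> real" where
  "riesz_weight \<sigma> z = inverse (norm z powr (real DIM('a) + 2 * \<sigma>))"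

lemma riesz_weight_nonneg [simp]: "0 \<le> riesz_weight \<sigma> z"
  by (simp add: riesz_weight_def)

lemma riesz_weight_pos: "z \<noteq> 0 \<Longrightarrow> 0 < riesz_weight \<sigma> z"
  by (simp add: riesz_weight_def)

lemma riesz_weight_uminus [simp]: "riesz_weight \<sigma> (- z) = riesz_weight \<sigma> z"
  by (simp add: riesz_weight_def)

lemma riesz_weight_measurable [measurable]: "riesz_weight \<sigma> \<in> borel_measurable borel"
  unfolding riesz_weight_def[abs_def] by measurable

lemma riesz_weight_ge:
  fixes z :: "'a::euclidean_space"
  assumes "z \<noteq> 0" "norm z \<le> s" "\<sigma> > 0"
  shows "s powr - (real DIM('a) + 2 * \<sigma>) \<le> riesz_weight \<sigma> z"
  unfolding riesz_weight_def powr_minus[symmetric] using assms by (intro powr_mono2') auto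

lemma riesz_weight_le:
  fixes z :: "'a::euclidean_space"
  assumes "0 < s" "s \<le> norm z" "\<sigma> > 0"
  shows "riesz_weight \<sigma> z \<le> s powr - (real DIM('a) + 2 * \<sigma>)"
  unfolding riesz_weight_def powr_minus[symmetric] using assms by (intro powr_mono2') auto

text \<open>At each point with \<open>f z > 0\<close> one term of the series of \<open>a k\<close>
  times the indicator of \<open>ball 0 (r k)\<close> dominates \<open>f\<close>. By
  \<open>ar\<close> the integral of that series is geometric with ratio \<open>q\<close>. It serves
  for dyadic decompositions, with radii growing (tail) or shrinking (second moment).\<close>

lemma integral_le_ball_series:
  fixes f :: "'a::euclidean_space \<Rightarrow> real"
  assumes [measurable]: "f \<in> borel_measurable borel" and f0: "\<And>z. 0 \<le> f z"
    and a: "\<And>k. 0 \<le> a k" and r: "\<And>k. 0 < r k"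
    and ar: "\<And>k. a k * r k ^ DIM('a) = B * q ^ k" and q: "0 \<le> q" "q < 1"
    and cover: "\<And>z. 0 < f z \<Longrightarrow> \<exists>k. norm z < r k \<and> f z \<le> a k"
  shows "integrable lborel f" "(\<integral>z. f z \<partial>lborel) \<le> unit_ball_vol DIM('a) * B / (1 - q)"
proof -
  have "B \<ge> 0" using ar[of 0] a[of 0] r[of 0] by (metis mult.right_neutral power_0 zero_le_mult_iff zero_le_power less_le)
  have V: "unit_ball_vol (real DIM('a)) > 0" by simp
  have term_le: "g k \<le> (\<Sum>k. g k)" for g :: "nat \<Rightarrow> ennreal" and k
    using sum_le_suminf[of g "{k}"] by simp
  have bound: "ennreal (f z) \<le> (\<Sum>k. ennreal (a k) * indicator (ball 0 (r k)) z)" for z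
  proof (cases "0 < f z")
    case True
    then obtain k where k: "norm z < r k" "f z \<le> a k" using cover by blast
    then have "ennreal (f z) \<le> ennreal (a k) * indicator (ball 0 (r k)) z"
      by (simp add: ennreal_leI)
    also have "\<dots> \<le> (\<Sum>k. ennreal (a k) * indicator (ball 0 (r k)) z)"
      by (rule term_le)
    finally show ?thesis .
  next
    case False
    then show ?thesis using f0[of z] by simp
  qed
  have "(\<integral>\<^sup>+z. ennreal (f z) \<partial>lborel)
      \<le> (\<integral>\<^sup>+z. (\<Sum>k. ennreal (a k) * indicator (ball (0::'a) (r k)) z) \<partial>lborel)"
    by (rule nn_integral_mono, rule bound)
  also have "\<dots> = (\<Sum>k. ennreal (a k) * emeasure lborel (ball (0::'a) (r k)))"
    by (subst nn_integral_suminf) (auto simp: nn_integral_cmult_indicator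
        intro!: borel_measurable_times_ennreal borel_measurable_indicator)
  also have "\<dots> = (\<Sum>k. ennreal (unit_ball_vol DIM('a) * B * q ^ k))"
  proof (intro suminf_cong)
    fix k
    have "ennreal (a k) * emeasure lborel (ball (0::'a) (r k))
        = ennreal (a k * (unit_ball_vol DIM('a) * r k ^ DIM('a)))"
      using a[of k] r[of k] by (simp add: emeasure_ball less_imp_le ennreal_mult)
    also have "a k * (unit_ball_vol DIM('a) * r k ^ DIM('a)) = unit_ball_vol DIM('a) * B * q ^ k"
      using ar[of k] by (simp add: mult_ac)
    finally show "ennreal (a k) * emeasure lborel (ball (0::'a) (r k))
        = ennreal (unit_ball_vol DIM('a) * B * q ^ k)" .
  qed
  also have "\<dots> = ennreal (unit_ball_vol DIM('a) * B / (1 - q))"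
  proof -
    have "(\<lambda>k. unit_ball_vol DIM('a) * B * q ^ k) sums (unit_ball_vol DIM('a) * B * (1 / (1 - q)))"
      using q by (intro sums_mult geometric_sums) simp
    then show ?thesis
      using \<open>B \<ge> 0\<close> V q by (subst suminf_ennreal_eq) (auto intro!: mult_nonneg_nonneg)
  qed
  finally have le: "(\<integral>\<^sup>+z. ennreal (f z) \<partial>lborel) \<le> ennreal (unit_ball_vol DIM('a) * B / (1 - q))" .
  then have "(\<integral>\<^sup>+z. ennreal (f z) \<partial>lborel) < \<infinity>"
    using ennreal_less_top le_less_trans by (metis infinity_ennreal_def)
  then show int: "integrable lborel f"
    using f0 by (intro integrableI_nonneg) auto
  have "unit_ball_vol DIM('a) * B / (1 - q) \<ge> 0" using \<open>B \<ge> 0\<close> V q by simp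
  then show "(\<integral>z. f z \<partial>lborel) \<le> unit_ball_vol DIM('a) * B / (1 - q)"
    using le f0 nn_integral_eq_integral[OF int] by simp
qed

text \<open>Dyadic shells \<open>R * 2 ^ k \<le> norm z < R * 2 ^ Suc k\<close>: kernel bound times
  volume scales like \<open>(R * 2 ^ k) powr (- 2 * \<sigma>)\<close>, which is summable because
  \<sigma> > 0.\<close>

lemma riesz_weight_tail:
  assumes "\<sigma> > 0"
  shows "\<exists>C>0. \<forall>R>0.
    integrable lborel (\<lambda>z::'a::euclidean_space. indicator (- ball 0 R) z * riesz_weight \<sigma> z) \<and>
    (\<integral>z. indicator (- ball (0::'a) R) z * riesz_weight \<sigma> z \<partial>lborel) \<le> C * R powr (- 2 * \<sigma>)"
proof -
  let ?N = "real DIM('a)"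
  define q :: real where "q = 2 powr (- 2 * \<sigma>)"
  have "2 powr (- 2 * \<sigma>) < 2 powr (0::real)" using assms by (intro powr_less_mono) auto
  then have q: "0 < q" "q < 1" by (auto simp: q_def)
  define C where "C = unit_ball_vol ?N * 2 ^ DIM('a) / (1 - q)"
  have "integrable lborel (\<lambda>z::'a. indicator (- ball 0 R) z * riesz_weight \<sigma> z) \<and>
      (\<integral>z. indicator (- ball (0::'a) R) z * riesz_weight \<sigma> z \<partial>lborel) \<le> C * R powr (- 2 * \<sigma>)"
    if R: "R > 0" for R
  proof -
    define f where "f z = indicator (- ball (0::'a) R) z * riesz_weight \<sigma> z" for z
    \<comment> \<open>\<open>a k\<close> bounds the kernel at the inner radius of the k-th shell,
      while \<open>r k\<close> is the outer radius.\<close>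
    define a where "a k = (R * 2 ^ k) powr - (?N + 2 * \<sigma>)" for k :: nat
    define r where "r k = R * 2 ^ (Suc k)" for k :: nat
    define B where "B = 2 ^ DIM('a) * R powr (- 2 * \<sigma>)"
    have ar: "a k * r k ^ DIM('a) = B * q ^ k" for k
    proof -
      have "a k * r k ^ DIM('a)
          = (R * 2 ^ k) powr - (?N + 2 * \<sigma>) * ((R * 2 ^ k) powr ?N * 2 ^ DIM('a))"
        using R by (simp add: a_def r_def powr_realpow power_mult_distrib mult_ac)
      also have "\<dots> = (R * 2 ^ k) powr (- 2 * \<sigma>) * 2 ^ DIM('a)"
        by (simp add: powr_add[symmetric] mult.assoc[symmetric])
      also have "(2 ^ k :: real) powr (- 2 * \<sigma>) = q ^ k"
        by (simp add: q_def powr_power powr_realpow[symmetric] powr_powr mult_ac)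
      then have "(R * 2 ^ k) powr (- 2 * \<sigma>) = R powr (- 2 * \<sigma>) * q ^ k"
        using R by (simp add: powr_mult)
      finally show ?thesis by (simp add: B_def mult_ac)
    qed
    have cover: "\<exists>k. norm z < r k \<and> f z \<le> a k" if "0 < f z" for z
    proof -
      have Rz: "R \<le> norm z" using that by (cases "norm z < R") (auto simp: f_def)
      have "\<exists>n. norm z < R * 2 ^ n"
        using real_arch_pow[of 2 "norm z / R"] R by (auto simp: field_simps)
      \<comment> \<open>The least such \<open>n\<close> is not 0 because
        \<open>R \<le> norm z\<close>; its predecessor indexes the shell containing
        \<open>z\<close>.\<close>
      then obtain n where n: "norm z < R * 2 ^ n" "\<And>m. m < n \<Longrightarrow> \<not> norm z < R * 2 ^ m"
        using exists_least_iff[of "\<lambda>n. norm z < R * 2 ^ n"] by auto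
      with Rz obtain k where k: "n = Suc k" by (cases n) auto
      have "f z \<le> a k"
        using n(2)[of k] k R assms riesz_weight_le[of "R * 2 ^ k" z \<sigma>]
        by (auto simp: f_def a_def indicator_def)
      then show ?thesis using n k by (auto simp: r_def)
    qed
    have m: "f \<in> borel_measurable borel"
      unfolding f_def[abs_def] by (intro borel_measurable_times borel_measurable_indicator) auto
    note series = integral_le_ball_series[of f a r B q, OF m _ _ _ ar _ _ cover]
    have "integrable lborel f"
      using R q by (intro series) (auto simp: f_def a_def r_def)
    moreover have "(\<integral>z. f z \<partial>lborel) \<le> unit_ball_vol ?N * B / (1 - q)"
      using R q by (intro series) (auto simp: f_def a_def r_def)
    ultimately show ?thesis by (simp add: f_def[abs_def] B_def C_def)
  qed
  moreover have "C > 0" using q by (simp add: C_def)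
  ultimately show ?thesis by blast
qed

text \<open>Now the shells shrink towards the origin. The factor \<open>(norm z)\<^sup>2\<close>
  turns the scaling into \<open>r k powr (2 - 2 * \<sigma>)\<close>, which is summable because
  \<sigma> < 1.\<close>

lemma riesz_weight_second_moment:
  assumes "0 < \<sigma>" "\<sigma> < 1"
  shows "\<exists>C>0. \<forall>R>0.
    integrable lborel
      (\<lambda>z::'a::euclidean_space. indicator (ball 0 R) z * ((norm z)\<^sup>2 * riesz_weight \<sigma> z)) \<and>
    (\<integral>z. indicator (ball (0::'a) R) z * ((norm z)\<^sup>2 * riesz_weight \<sigma> z) \<partial>lborel)
      \<le> C * R powr (2 - 2 * \<sigma>)"
proof -
  let ?N = "real DIM('a)"
  define q :: real where "q = (1/2) powr (2 - 2 * \<sigma>)"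
  have "(1/2) powr (2 - 2 * \<sigma>) < (1::real)" using assms powr_less_mono2[of "2 - 2 * \<sigma>" "1/2" 1] by simp
  then have q: "0 < q" "q < 1" by (auto simp: q_def)
  define D :: real where "D = (1/2) powr - (?N + 2 * \<sigma>)"
  define C where "C = unit_ball_vol ?N * D / (1 - q)"
  have "integrable lborel (\<lambda>z::'a. indicator (ball 0 R) z * ((norm z)\<^sup>2 * riesz_weight \<sigma> z)) \<and>
      (\<integral>z. indicator (ball (0::'a) R) z * ((norm z)\<^sup>2 * riesz_weight \<sigma> z) \<partial>lborel)
        \<le> C * R powr (2 - 2 * \<sigma>)"
    if R: "R > 0" for R
  proof -
    define f where "f z = indicator (ball (0::'a) R) z * ((norm z)\<^sup>2 * riesz_weight \<sigma> z)" for z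
    define r where "r k = R * (1/2) ^ k" for k :: nat
    \<comment> \<open>On the shell \<open>r k / 2 \<le> norm z < r k\<close>, the square is bounded
      at the outer radius and the kernel at the inner one.\<close>
    define a where "a k = (r k)\<^sup>2 * (r k * (1/2)) powr - (?N + 2 * \<sigma>)" for k :: nat
    define B where "B = D * R powr (2 - 2 * \<sigma>)"
    have r_pos: "r k > 0" for k using R by (simp add: r_def)
    have ar: "a k * r k ^ DIM('a) = B * q ^ k" for k
    proof -
      have "(r k * (1/2)) powr - (?N + 2 * \<sigma>) = r k powr - (?N + 2 * \<sigma>) * D"
        using r_pos[of k] unfolding D_def by (subst powr_mult) auto
      then have "a k * r k ^ DIM('a) = r k powr 2 * (r k powr - (?N + 2 * \<sigma>) * D) * r k powr ?N"
        using r_pos[of k] by (simp only: a_def powr_realpow powr_numeral)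
      also have "\<dots> = D * r k powr (2 - 2 * \<sigma>)"
      proof -
        have "2 - 2 * \<sigma> = 2 + (- (?N + 2 * \<sigma>) + ?N)" by simp
        then show ?thesis by (simp only: powr_add mult_ac)
      qed
      also have "((1/2) ^ k :: real) powr (2 - 2 * \<sigma>) = q ^ k"
        by (simp add: q_def powr_power powr_realpow[symmetric] powr_powr mult_ac)
      then have "r k powr (2 - 2 * \<sigma>) = R powr (2 - 2 * \<sigma>) * q ^ k"
        using R by (simp add: powr_mult r_def)
      finally show ?thesis by (simp add: B_def mult_ac)
    qed
    have cover: "\<exists>k. norm z < r k \<and> f z \<le> a k" if "0 < f z" for z
    proof -
      have Rz: "norm z < R" and z: "z \<noteq> 0"
        using that by (cases "norm z < R", auto simp: f_def)+
      have "\<exists>n. r n \<le> norm z"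
        using real_arch_pow_inv[of "norm z / R" "1/2"] R z
        by (auto simp: r_def field_simps intro: less_imp_le)
      then obtain n where n: "r n \<le> norm z" "\<And>m. m < n \<Longrightarrow> \<not> r m \<le> norm z"
        using exists_least_iff[of "\<lambda>n. r n \<le> norm z"] by auto
      with Rz obtain k where k: "n = Suc k" by (cases n) (auto simp: r_def)
      have zk: "norm z < r k" using n(2)[of k] k by simp
      have "r k * (1/2) \<le> norm z" using n(1) k by (simp add: r_def mult_ac)
      then have "riesz_weight \<sigma> z \<le> (r k * (1/2)) powr - (?N + 2 * \<sigma>)"
        using r_pos[of k] assms by (intro riesz_weight_le) auto
      moreover have "(norm z)\<^sup>2 \<le> (r k)\<^sup>2" using zk by (intro power_mono) auto
      ultimately have "(norm z)\<^sup>2 * riesz_weight \<sigma> z \<le> a k"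
        unfolding a_def by (intro mult_mono) auto
      then have "f z \<le> a k" using Rz by (simp add: f_def)
      then show ?thesis using zk by auto
    qed
    have m: "f \<in> borel_measurable borel"
      unfolding f_def[abs_def] by (intro borel_measurable_times borel_measurable_indicator) auto
    note series = integral_le_ball_series[of f a r B q, OF m _ _ _ ar _ _ cover]
    have "integrable lborel f"
      using R q by (intro series) (auto simp: f_def a_def r_def)
    moreover have "(\<integral>z. f z \<partial>lborel) \<le> unit_ball_vol ?N * B / (1 - q)"
      using R q by (intro series) (auto simp: f_def a_def r_def)
    ultimately show ?thesis by (simp add: f_def[abs_def] B_def C_def mult_ac)
  qed
  moreover have "C > 0" using q by (simp add: C_def D_def)
  ultimately show ?thesis by blast
qed

section \<open>Positivity of the normalising constant\<close>

lemma one_minus_cos_le: "1 - cos t \<le> (t::real)\<^sup>2"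
proof -
  have "1 - cos t = 2 * (sin (t / 2))\<^sup>2"
    using cos_double_sin[of "t / 2"] by simp
  also have "(sin (t / 2))\<^sup>2 \<le> (t / 2)\<^sup>2"
    using abs_sin_x_le_abs_x[of "t / 2"] abs_le_square_iff by blast
  finally have "1 - cos t \<le> t\<^sup>2 / 2" by (simp add: power_divide)
  then show ?thesis using zero_le_power2[of t] by linarith
qed

text \<open>
  Cancellation of the odd part turns \<open>1 - exp(\<i> \<xi> \<bullet> z)\<close> into \<open>1 - cos(\<xi> \<bullet> z)\<close>, so this is the
  symbol of the operator before normalisation.
\<close>

definition cos_moment :: "real \<Rightarrow> 'a::euclidean_space \<Rightarrow> real" where
  "cos_moment \<sigma> \<xi> = (\<integral>z. (1 - cos (\<xi> \<bullet> z)) * riesz_weight \<sigma> z \<partial>lborel)"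

text \<open>Split at the unit sphere: inside, \<open>1 - cos t \<le> t\<^sup>2\<close> reduces to
  the second moment; outside, \<open>1 - cos t \<le> 2\<close> reduces to the tail.\<close>

lemma cos_moment_integrable:
  fixes \<xi> :: "'a::euclidean_space"
  assumes "0 < \<sigma>" "\<sigma> < 1"
  shows "integrable lborel (\<lambda>z. (1 - cos (\<xi> \<bullet> z)) * riesz_weight \<sigma> z)"
proof -
  have int: "integrable lborel (\<lambda>z::'a. (norm \<xi>)\<^sup>2 *
      (indicator (ball 0 1) z * ((norm z)\<^sup>2 * riesz_weight \<sigma> z))
      + 2 * (indicator (- ball 0 1) z * riesz_weight \<sigma> z))"
  proof (intro Bochner_Integration.integrable_add integrable_mult_right)
    show "integrable lborel (\<lambda>z::'a. indicator (ball 0 1) z * ((norm z)\<^sup>2 * riesz_weight \<sigma> z))"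
      using riesz_weight_second_moment[OF assms, where 'a='a] zero_less_one by blast
    show "integrable lborel (\<lambda>z::'a. indicator (- ball 0 1) z * riesz_weight \<sigma> z)"
      using riesz_weight_tail[OF assms(1), where 'a='a] zero_less_one by blast
  qed
  show ?thesis
  proof (rule Bochner_Integration.integrable_bound[OF int])
    have "norm ((1 - cos (\<xi> \<bullet> z)) * riesz_weight \<sigma> z) \<le> norm ((norm \<xi>)\<^sup>2 *
      (indicator (ball 0 1) z * ((norm z)\<^sup>2 * riesz_weight \<sigma> z))
      + 2 * (indicator (- ball 0 1) z * riesz_weight \<sigma> z))" for z :: 'a
    proof (cases "norm z < 1")
      case True
      have "(\<xi> \<bullet> z)\<^sup>2 \<le> (norm \<xi> * norm z)\<^sup>2"
        using Cauchy_Schwarz_ineq[of \<xi> z] by (simp add: power_mult_distrib power2_norm_eq_inner)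
      then have "1 - cos (\<xi> \<bullet> z) \<le> (norm \<xi>)\<^sup>2 * (norm z)\<^sup>2"
        using one_minus_cos_le[of "\<xi> \<bullet> z"] by (simp add: power_mult_distrib)
      then have "(1 - cos (\<xi> \<bullet> z)) * riesz_weight \<sigma> z \<le> (norm \<xi>)\<^sup>2 * (norm z)\<^sup>2 * riesz_weight \<sigma> z"
        by (intro mult_right_mono) auto
      then show ?thesis using True by (simp add: abs_mult mult.assoc)
    next
      case False
      have "1 - cos (\<xi> \<bullet> z) \<le> 2" using cos_ge_minus_one[of "\<xi> \<bullet> z"] by linarith
      then have "(1 - cos (\<xi> \<bullet> z)) * riesz_weight \<sigma> z \<le> 2 * riesz_weight \<sigma> z"
        by (intro mult_right_mono) auto
      then show ?thesis using False by (simp add: abs_mult)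
    qed
    then show "AE z in lborel. norm ((1 - cos (\<xi> \<bullet> z)) * riesz_weight \<sigma> z) \<le> norm ((norm \<xi>)\<^sup>2 *
      (indicator (ball 0 1) z * ((norm z)\<^sup>2 * riesz_weight \<sigma> z))
      + 2 * (indicator (- ball 0 1) z * riesz_weight \<sigma> z))" by simp
  qed simp
qed

text \<open>Substitute \<open>s *\<^sub>R z\<close> for \<open>z\<close>: the Jacobian
  \<open>s ^ DIM('a)\<close> against the homogeneity \<open>- (DIM('a) + 2 * \<sigma>)\<close> of
  the kernel leaves the power \<open>2 * \<sigma>\<close>.\<close>

lemma cos_moment_scaleR:
  fixes \<xi> :: "'a::euclidean_space"
  assumes s: "s > 0"
  shows "cos_moment \<sigma> (s *\<^sub>R \<xi>) = s powr (2 * \<sigma>) * cos_moment \<sigma> \<xi>"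
proof -
  let ?d = "real DIM('a) + 2 * \<sigma>"
  have w: "riesz_weight \<sigma> (s *\<^sub>R z) = s powr - ?d * riesz_weight \<sigma> z" for z :: 'a
  proof -
    have "(s * norm z) powr ?d = s powr ?d * norm z powr ?d"
      using s by (subst powr_mult) auto
    then show ?thesis
      using s unfolding riesz_weight_def powr_minus by (simp only: norm_scaleR abs_of_pos inverse_mult_distrib)
  qed
  have "cos_moment \<sigma> \<xi> = s ^ DIM('a) *
      (\<integral>z. (1 - cos (\<xi> \<bullet> (s *\<^sub>R z))) * riesz_weight \<sigma> (s *\<^sub>R z) \<partial>lborel)"
    unfolding cos_moment_def by (rule integral_lborel_scaleR[OF _ s]) measurable
  also have "(\<integral>z. (1 - cos (\<xi> \<bullet> (s *\<^sub>R z))) * riesz_weight \<sigma> (s *\<^sub>R z) \<partial>lborel)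
      = (\<integral>z. s powr - ?d * ((1 - cos ((s *\<^sub>R \<xi>) \<bullet> z)) * riesz_weight \<sigma> z) \<partial>lborel)"
    by (intro Bochner_Integration.integral_cong) (auto simp: w)
  also have "\<dots> = s powr - ?d * cos_moment \<sigma> (s *\<^sub>R \<xi>)"
    by (simp add: cos_moment_def)
  finally have "s powr (2 * \<sigma>) * cos_moment \<sigma> \<xi>
      = (s powr (2 * \<sigma>) * s powr real DIM('a) * s powr - ?d) * cos_moment \<sigma> (s *\<^sub>R \<xi>)"
    using s by (simp only: powr_realpow mult.assoc)
  also have "s powr (2 * \<sigma>) * s powr real DIM('a) * s powr - ?d = 1"
    using s by (simp add: powr_add[symmetric])
  finally show ?thesis by simp
qed

text \<open>An orthogonal map carrying \<open>a\<close> to \<open>b\<close> preserves both Lebesgue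
  measure and the kernel.\<close>

lemma cos_moment_cong_norm:
  fixes a b :: "'a::euclidean_space"
  assumes "norm a = norm b"
  shows "cos_moment \<sigma> a = cos_moment \<sigma> b"
proof -
  obtain T where T: "orthogonal_transformation T" "T a = b"
    using householder_reflection[OF assms] by metis
  have "cos_moment \<sigma> b = (\<integral>z. (1 - cos (b \<bullet> T z)) * riesz_weight \<sigma> (T z) \<partial>lborel)"
    unfolding cos_moment_def by (rule integral_lborel_orthogonal[OF T(1), symmetric]) measurable
  moreover have "b \<bullet> T z = a \<bullet> z" for z using T by (metis orthogonal_transformation_def)
  moreover have "riesz_weight \<sigma> (T z) = riesz_weight \<sigma> z" for z
    using T by (simp add: riesz_weight_def orthogonal_transformation_norm)
  ultimately show ?thesis by (simp add: cos_moment_def)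
qed

lemma cos_moment_pos:
  fixes \<xi> :: "'a::euclidean_space"
  assumes "0 < \<sigma>" "\<sigma> < 1" "\<xi> \<noteq> 0"
  shows "0 < cos_moment \<sigma> \<xi>"
proof -
  let ?f = "\<lambda>z. (1 - cos (\<xi> \<bullet> z)) * riesz_weight \<sigma> z"
  have nn: "0 \<le> ?f z" for z by (simp add: mult_nonneg_nonneg)
  have "cos_moment \<sigma> \<xi> \<noteq> 0"
  proof
    assume "cos_moment \<sigma> \<xi> = 0"
    then have ae: "AE z in lborel. ?f z = 0"
      using integral_nonneg_eq_0_iff_AE[OF cos_moment_integrable[OF assms(1,2), of \<xi>]] nn
      by (simp add: cos_moment_def)
    \<comment> \<open>\<open>w\<close> satisfies \<open>\<xi> \<bullet> w = 1\<close>, and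
      \<open>r\<close> keeps \<open>\<xi> \<bullet> z\<close> within 1/2 of 1 on
      \<open>ball w r\<close>. There \<open>\<xi> \<bullet> z\<close> lies strictly between 0 and
      pi, so the cosine is below 1 and the integrand is positive on a set of positive
      measure.\<close>
    define w where "w = (1 / (\<xi> \<bullet> \<xi>)) *\<^sub>R \<xi>"
    define r where "r = 1 / (2 * norm \<xi>)"
    have r: "r > 0" using assms by (simp add: r_def)
    have "?f z \<noteq> 0" if "z \<in> ball w r" for z
    proof -
      have "\<bar>\<xi> \<bullet> (z - w)\<bar> \<le> norm \<xi> * norm (z - w)" by (rule Cauchy_Schwarz_ineq2)
      also have "\<dots> < norm \<xi> * r"
        using that assms by (intro mult_strict_left_mono) (auto simp: dist_norm norm_minus_commute)
      also have "\<dots> = 1/2" using assms by (simp add: r_def)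
      finally have "\<bar>\<xi> \<bullet> z - 1\<bar> < 1/2"
        using assms by (simp add: inner_diff_right w_def)
      then have t: "0 < \<xi> \<bullet> z" "\<xi> \<bullet> z < 2" by linarith+
      then have "cos (\<xi> \<bullet> z) < cos 0" using pi_gt3 by (intro cos_monotone_0_pi) auto
      moreover have "z \<noteq> 0" using t by auto
      ultimately show ?thesis using riesz_weight_pos[of z \<sigma>] by simp
    qed
    then have "AE z in lborel. z \<notin> ball w r" using ae by (auto elim!: eventually_mono)
    then have "emeasure lborel (ball w r) = 0"
      by (subst (asm) AE_iff_measurable[of "ball w r"]) auto
    moreover have "unit_ball_vol (real DIM('a)) * r ^ DIM('a) > 0" using r by simp
    ultimately show False
      using r by (simp add: emeasure_ball ennreal_eq_0_iff del: unit_ball_vol_pos)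
  qed
  moreover have "cos_moment \<sigma> \<xi> \<ge> 0"
    unfolding cos_moment_def using nn by (intro Bochner_Integration.integral_nonneg) auto
  ultimately show ?thesis by simp
qed

text \<open>Rotation and scaling reduce the symbol to its value at one unit vector; the reciprocal
  of that number is the normalising constant.\<close>

lemma cos_moment_eq:
  fixes \<xi> e :: "'a::euclidean_space"
  assumes "norm e = 1" "\<sigma> > 0"
  shows "cos_moment \<sigma> \<xi> = norm \<xi> powr (2 * \<sigma>) * cos_moment \<sigma> e"
proof (cases "\<xi> = 0")
  case True
  then show ?thesis by (simp add: cos_moment_def)
next
  case False
  then have "cos_moment \<sigma> (norm \<xi> *\<^sub>R e) = norm \<xi> powr (2 * \<sigma>) * cos_moment \<sigma> e"
    by (intro cos_moment_scaleR) auto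
  then show ?thesis
    using cos_moment_cong_norm[of \<xi> "norm \<xi> *\<^sub>R e" \<sigma>] assms by simp
qed

section \<open>Action of the truncated operator on plane waves\<close>

lemma frac_lap_trunc_eq_riesz_weight:
  fixes u :: "'a::euclidean_space \<Rightarrow> 'b::{banach, second_countable_topology}"
  shows "frac_lap_trunc \<sigma> u x \<epsilon> =
    (\<integral>z. indicator (- ball 0 \<epsilon>) (z - x) *\<^sub>R (riesz_weight \<sigma> (z - x) *\<^sub>R (u x - u z)) \<partial>lebesgue)"
  unfolding frac_lap_trunc_def set_lebesgue_integral_def riesz_weight_def
  by (intro Bochner_Integration.integral_cong)
     (auto simp: indicator_def dist_norm norm_minus_commute)

lemma frac_lap_trunc_cis:
  fixes \<xi> x :: "'a::euclidean_space"
  assumes "0 < \<sigma>" "\<sigma> < 1" "0 < \<epsilon>"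
  shows "frac_lap_trunc \<sigma> (\<lambda>y. cis (\<xi> \<bullet> y)) x \<epsilon> =
    (\<integral>z. indicator (- ball 0 \<epsilon>) z * ((1 - cos (\<xi> \<bullet> z)) * riesz_weight \<sigma> z) \<partial>lborel) *\<^sub>R cis (\<xi> \<bullet> x)"
proof -
  \<comment> \<open>The integrand after factoring out \<open>cis (\<xi> \<bullet> x)\<close> and
    substituting \<open>z = y - x\<close>.\<close>
  define g where "g z = (indicator (- ball 0 \<epsilon>) z * riesz_weight \<sigma> z) *\<^sub>R (1 - cis (\<xi> \<bullet> z))" for z
  have cis_m: "(\<lambda>z. cis (\<xi> \<bullet> z)) \<in> borel_measurable borel"
    by (intro borel_measurable_continuous_onI continuous_intros)
  have ind_m: "(\<lambda>z::'a. indicator (- ball 0 \<epsilon>) z :: real) \<in> borel_measurable borel"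
    by (intro borel_measurable_indicator) auto
  have g_m: "g \<in> borel_measurable borel"
    unfolding g_def[abs_def] using cis_m ind_m by measurable
  have tail: "integrable lborel (\<lambda>z::'a. indicator (- ball 0 \<epsilon>) z * riesz_weight \<sigma> z)"
    using assms(3) riesz_weight_tail[OF assms(1), where 'a='a] by blast
  have g_int: "integrable lborel g"
  proof (rule Bochner_Integration.integrable_bound[OF integrable_mult_right[OF tail, of 2]])
    have "norm (1 - cis t) \<le> 2" for t using norm_triangle_ineq4[of 1 "cis t"] by simp
    then have "riesz_weight \<sigma> z * norm (1 - cis (\<xi> \<bullet> z)) \<le> riesz_weight \<sigma> z * 2" for z
      by (intro mult_left_mono) auto
    then have "norm (g z) \<le> norm (2 * (indicator (- ball 0 \<epsilon>) z * riesz_weight \<sigma> z))" for z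
      by (cases "norm z < \<epsilon>") (auto simp: g_def abs_mult mult.commute[of 2])
    then show "AE z in lborel. norm (g z) \<le> norm (2 * (indicator (- ball 0 \<epsilon>) z * riesz_weight \<sigma> z))"
      by simp
  qed (use g_m in simp)
  let ?J = "\<integral>z. g z \<partial>lborel"
  let ?I = "\<integral>z. indicator (- ball 0 \<epsilon>) z * ((1 - cos (\<xi> \<bullet> z)) * riesz_weight \<sigma> z) \<partial>lborel"
  have g_int': "integrable lborel (\<lambda>z. g (- z))"
  proof -
    have "integrable (distr lborel borel uminus) g"
      using g_int by (subst distr_lborel_orthogonal) (auto simp: orthogonal_transformation_neg)
    then show ?thesis using g_m by (subst (asm) integrable_distr_eq) auto
  qed
  \<comment> \<open>Averaging over \<open>z\<close> and \<open>- z\<close> removes the sine and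
    leaves a real integrand.\<close>
  have "?J + ?J = (\<integral>z. g z + g (- z) \<partial>lborel)"
    using integral_lborel_uminus[OF g_m] g_int g_int'
    by (subst Bochner_Integration.integral_add) auto
  also have "\<dots> = (\<integral>z. complex_of_real
      (2 * (indicator (- ball 0 \<epsilon>) z * ((1 - cos (\<xi> \<bullet> z)) * riesz_weight \<sigma> z))) \<partial>lborel)"
  proof (rule Bochner_Integration.integral_cong)
    fix z
    show "g z + g (- z) = complex_of_real
      (2 * (indicator (- ball 0 \<epsilon>) z * ((1 - cos (\<xi> \<bullet> z)) * riesz_weight \<sigma> z)))"
      by (cases "norm z < \<epsilon>") (auto simp: g_def complex_eq_iff algebra_simps)
  qed simp
  also have "\<dots> = complex_of_real (2 * ?I)"
    by (simp only: integral_complex_of_real integral_mult_right_zero)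
  finally have J: "?J = complex_of_real ?I" by (simp add: complex_eq_iff)
  have "frac_lap_trunc \<sigma> (\<lambda>y. cis (\<xi> \<bullet> y)) x \<epsilon> =
      (\<integral>y. cis (\<xi> \<bullet> x) * g (y - x) \<partial>lebesgue)"
    unfolding frac_lap_trunc_eq_riesz_weight
  proof (rule Bochner_Integration.integral_cong)
    fix y
    have "cis (\<xi> \<bullet> y) = cis (\<xi> \<bullet> x) * cis (\<xi> \<bullet> (y - x))"
      by (simp add: cis_mult inner_diff_right)
    then show "indicator (- ball 0 \<epsilon>) (y - x) *\<^sub>R
        (riesz_weight \<sigma> (y - x) *\<^sub>R (cis (\<xi> \<bullet> x) - cis (\<xi> \<bullet> y))) = cis (\<xi> \<bullet> x) * g (y - x)"
      by (simp add: g_def right_diff_distrib)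
  qed simp
  also have "\<dots> = (\<integral>y. cis (\<xi> \<bullet> x) * g (y - x) \<partial>lborel)"
  proof (rule integral_completion)
    have "(\<lambda>y. g (y - x)) \<in> borel_measurable borel"
      using g_m by (rule measurable_compose[rotated]) measurable
    then show "(\<lambda>y. cis (\<xi> \<bullet> x) * g (y - x)) \<in> borel_measurable lborel" by simp
  qed
  also have "\<dots> = cis (\<xi> \<bullet> x) * (\<integral>y. g (y - x) \<partial>lborel)" by simp
  also have "(\<integral>y. g (y - x) \<partial>lborel) = ?J"
    using integral_lborel_translation[OF g_m, of "- x"] by simp
  finally show ?thesis by (simp add: J scaleR_conv_of_real mult.commute)
qed

text \<open>What the truncation omits is the integral over \<open>ball 0 \<epsilon>\<close>, which
  the second moment bounds by a multiple of
  \<open>\<epsilon> powr (2 - 2 * \<sigma>)\<close>.\<close>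

lemma frac_lap_trunc_cis_tendsto:
  fixes \<xi> x :: "'a::euclidean_space"
  assumes s: "0 < \<sigma>" "\<sigma> < 1"
  shows "((\<lambda>\<epsilon>. frac_lap_trunc \<sigma> (\<lambda>y. cis (\<xi> \<bullet> y)) x \<epsilon>)
           \<longlongrightarrow> cos_moment \<sigma> \<xi> *\<^sub>R cis (\<xi> \<bullet> x)) (at_right 0)"
proof -
  obtain C where C: "C > 0"
    "\<And>R. R > 0 \<Longrightarrow> integrable lborel
       (\<lambda>z::'a::euclidean_space. indicator (ball 0 R) z * ((norm z)\<^sup>2 * riesz_weight \<sigma> z))"
    "\<And>R. R > 0 \<Longrightarrow> (\<integral>z. indicator (ball (0::'a) R) z * ((norm z)\<^sup>2 * riesz_weight \<sigma> z) \<partial>lborel)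
       \<le> C * R powr (2 - 2 * \<sigma>)"
    using riesz_weight_second_moment[OF s, where 'a='a] by blast
  let ?f = "\<lambda>z. (1 - cos (\<xi> \<bullet> z)) * riesz_weight \<sigma> z"
  define I where "I \<epsilon> = (\<integral>z. indicator (- ball 0 \<epsilon>) z * ?f z \<partial>lborel)" for \<epsilon>
  have f_int: "integrable lborel ?f" by (rule cos_moment_integrable[OF s])
  have diff: "\<bar>I \<epsilon> - cos_moment \<sigma> \<xi>\<bar> \<le> (norm \<xi>)\<^sup>2 * (C * \<epsilon> powr (2 - 2 * \<sigma>))" if "\<epsilon> > 0" for \<epsilon>
  proof -
    have i1: "integrable lborel (\<lambda>z. indicator (- ball 0 \<epsilon>) z * ?f z)"
      and i2: "integrable lborel (\<lambda>z. indicator (ball 0 \<epsilon>) z * ?f z)"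
      using integrable_mult_indicator[OF _ f_int, of "- ball 0 \<epsilon>"]
        integrable_mult_indicator[OF _ f_int, of "ball 0 \<epsilon>"] by simp_all
    have "cos_moment \<sigma> \<xi> = (\<integral>z. indicator (- ball 0 \<epsilon>) z * ?f z + indicator (ball 0 \<epsilon>) z * ?f z \<partial>lborel)"
      unfolding cos_moment_def
      by (intro Bochner_Integration.integral_cong) (auto simp: indicator_def)
    then have eq: "cos_moment \<sigma> \<xi> - I \<epsilon> = (\<integral>z. indicator (ball 0 \<epsilon>) z * ?f z \<partial>lborel)"
      using i1 i2 by (simp add: I_def)
    have "(\<integral>z. indicator (ball 0 \<epsilon>) z * ?f z \<partial>lborel)
      \<le> (\<integral>z. (norm \<xi>)\<^sup>2 * (indicator (ball (0::'a) \<epsilon>) z * ((norm z)\<^sup>2 * riesz_weight \<sigma> z)) \<partial>lborel)"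
    proof (rule integral_mono[OF i2])
      show "integrable lborel (\<lambda>z. (norm \<xi>)\<^sup>2 * (indicator (ball (0::'a) \<epsilon>) z * ((norm z)\<^sup>2 * riesz_weight \<sigma> z)))"
        using C(2)[OF that] by simp
      fix z
      have "(\<xi> \<bullet> z)\<^sup>2 \<le> (norm \<xi> * norm z)\<^sup>2"
        using Cauchy_Schwarz_ineq[of \<xi> z] by (simp add: power_mult_distrib power2_norm_eq_inner)
      then have "1 - cos (\<xi> \<bullet> z) \<le> (norm \<xi>)\<^sup>2 * (norm z)\<^sup>2"
        using one_minus_cos_le[of "\<xi> \<bullet> z"] by (simp add: power_mult_distrib)
      then have "?f z \<le> (norm \<xi>)\<^sup>2 * (norm z)\<^sup>2 * riesz_weight \<sigma> z"
        by (intro mult_right_mono) auto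
      then show "indicator (ball 0 \<epsilon>) z * ?f z
          \<le> (norm \<xi>)\<^sup>2 * (indicator (ball 0 \<epsilon>) z * ((norm z)\<^sup>2 * riesz_weight \<sigma> z))"
        by (simp add: indicator_def mult.assoc)
    qed
    also have "\<dots> \<le> (norm \<xi>)\<^sup>2 * (C * \<epsilon> powr (2 - 2 * \<sigma>))"
      using C(3)[OF that] by (simp add: mult_left_mono)
    moreover have "0 \<le> (\<integral>z. indicator (ball 0 \<epsilon>) z * ?f z \<partial>lborel)"
      by (intro Bochner_Integration.integral_nonneg) (auto intro!: mult_nonneg_nonneg)
    ultimately show ?thesis using eq by linarith
  qed
  have "((\<lambda>\<epsilon>::real. (norm \<xi>)\<^sup>2 * (C * \<epsilon> powr (2 - 2 * \<sigma>))) \<longlongrightarrow> 0) (at_right 0)"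
  proof -
    have "((\<lambda>\<epsilon>::real. \<epsilon> powr (2 - 2 * \<sigma>)) \<longlongrightarrow> 0) (at_right 0)"
      using s by (intro tendsto_zero_powrI[where b="2 - 2 * \<sigma>"] tendsto_intros)
        (auto simp: eventually_at_filter)
    then show ?thesis by (intro tendsto_mult_right_zero)
  qed
  moreover have "\<forall>\<^sub>F \<epsilon> in at_right 0.
      norm (I \<epsilon> - cos_moment \<sigma> \<xi>) \<le> (norm \<xi>)\<^sup>2 * (C * \<epsilon> powr (2 - 2 * \<sigma>))"
    using eventually_at_right_less[of "0::real"] by eventually_elim (simp add: diff)
  ultimately have "((\<lambda>\<epsilon>. I \<epsilon> - cos_moment \<sigma> \<xi>) \<longlongrightarrow> 0) (at_right 0)"
    by (rule Lim_null_comparison[rotated])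
  then have "(I \<longlongrightarrow> cos_moment \<sigma> \<xi>) (at_right 0)" by (rule LIM_zero_cancel)
  then have "((\<lambda>\<epsilon>. I \<epsilon> *\<^sub>R cis (\<xi> \<bullet> x)) \<longlongrightarrow> cos_moment \<sigma> \<xi> *\<^sub>R cis (\<xi> \<bullet> x)) (at_right 0)"
    by (intro tendsto_intros)
  then show ?thesis
  proof (rule Lim_transform_eventually)
    show "\<forall>\<^sub>F \<epsilon> in at_right 0. I \<epsilon> *\<^sub>R cis (\<xi> \<bullet> x) = frac_lap_trunc \<sigma> (\<lambda>y. cis (\<xi> \<bullet> y)) x \<epsilon>"
      using eventually_at_right_less[of "0::real"]
      by eventually_elim (simp add: frac_lap_trunc_cis[OF s] I_def)
  qed
qed

text \<open>The constant is a definite description, so its sign becomes known only after existence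
  and uniqueness are shown; its value is \<open>1 / A\<close>.\<close>

lemma frac_lap_const_pos:
  assumes s: "0 < \<sigma>" "\<sigma> < 1"
  shows "0 < frac_lap_const TYPE('a::euclidean_space) \<sigma>"
proof -
  obtain e :: 'a where e: "norm e = 1" using vector_choose_size[of 1] by auto
  define A where "A = cos_moment \<sigma> e"
  have A: "A > 0" unfolding A_def using e by (intro cos_moment_pos[OF s]) auto
  have lim: "((\<lambda>\<epsilon>. frac_lap_trunc \<sigma> (\<lambda>y. cis (\<xi> \<bullet> y)) x \<epsilon>)
      \<longlongrightarrow> (norm \<xi> powr (2 * \<sigma>) * A) *\<^sub>R cis (\<xi> \<bullet> x)) (at_right 0)" for \<xi> x :: 'a
    using frac_lap_trunc_cis_tendsto[OF s, of \<xi> x] cos_moment_eq[OF e s(1), of \<xi>] by (simp add: A_def)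
  have "frac_lap_const TYPE('a) \<sigma> = 1 / A"
    unfolding frac_lap_const_def
  proof (rule the_equality, intro conjI allI)
    show "0 < 1 / A" using A by simp
    show "((\<lambda>\<epsilon>. (1 / A) *\<^sub>R frac_lap_trunc \<sigma> (\<lambda>y. cis (\<xi> \<bullet> y)) x \<epsilon>)
        \<longlongrightarrow> norm \<xi> powr (2 * \<sigma>) *\<^sub>R cis (\<xi> \<bullet> x)) (at_right 0)" for \<xi> x :: 'a
      using tendsto_scaleR[OF tendsto_const lim[of \<xi> x], of "1 / A"] A by simp
    fix c :: real
    assume "0 < c \<and> (\<forall>\<xi> x :: 'a. ((\<lambda>\<epsilon>. c *\<^sub>R frac_lap_trunc \<sigma> (\<lambda>y. cis (\<xi> \<bullet> y)) x \<epsilon>)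
        \<longlongrightarrow> norm \<xi> powr (2 * \<sigma>) *\<^sub>R cis (\<xi> \<bullet> x)) (at_right 0))"
    \<comment> \<open>One test suffices for uniqueness: at the unit frequency \<open>e\<close> and
      the point 0 the limit is both 1 and \<open>c * A\<close>.\<close>
    then have "((\<lambda>\<epsilon>. c *\<^sub>R frac_lap_trunc \<sigma> (\<lambda>y. cis (e \<bullet> y)) 0 \<epsilon>)
        \<longlongrightarrow> norm e powr (2 * \<sigma>) *\<^sub>R cis (e \<bullet> 0)) (at_right 0)" by blast
    moreover have "((\<lambda>\<epsilon>. c *\<^sub>R frac_lap_trunc \<sigma> (\<lambda>y. cis (e \<bullet> y)) 0 \<epsilon>)
        \<longlongrightarrow> c *\<^sub>R ((norm e powr (2 * \<sigma>) * A) *\<^sub>R cis (e \<bullet> 0))) (at_right 0)"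
      by (intro tendsto_intros lim)
    ultimately have "norm e powr (2 * \<sigma>) *\<^sub>R cis (e \<bullet> 0) =
        c *\<^sub>R ((norm e powr (2 * \<sigma>) * A) *\<^sub>R cis (e \<bullet> 0))"
      by (intro tendsto_unique[OF _ _ _, of "at_right (0::real)"]) auto
    then show "c = 1 / A" using e A by (simp add: complex_eq_iff field_simps)
  qed
  then show ?thesis using A by simp
qed

section \<open>Bounds for functions touched from above by a paraboloid\<close>

lemma integrable_lborel_shift:
  fixes g :: "'a::euclidean_space \<Rightarrow> real"
  assumes "integrable lborel g"
  shows "integrable lborel (\<lambda>y. g (y - x))" "(\<integral>y. g (y - x) \<partial>lborel) = (\<integral>y. g y \<partial>lborel)"
proof -
  have m: "g \<in> borel_measurable borel" using assms by simp
  have "integrable (distr lborel borel ((+) (- x))) g"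
    using assms by (simp only: lborel_distr_plus)
  then show "integrable lborel (\<lambda>y. g (y - x))"
    using m by (subst (asm) integrable_distr_eq) auto
  show "(\<integral>y. g (y - x) \<partial>lborel) = (\<integral>y. g y \<partial>lborel)"
    using integral_lborel_translation[OF m, of "- x"] by simp
qed

text \<open>
  On \<open>ball x R\<close> the linear part of the paraboloid cancels by symmetry; outside, \<open>u y - u x \<le> \<delta>\<close> except on
  \<open>E\<close>, where a drop of at least \<open>m\<close> contributes the main term.
\<close>

lemma has_frac_laplacian_lower_bound:
  fixes u :: "'a::euclidean_space \<Rightarrow> real"
  assumes s: "0 < \<sigma>" "\<sigma> < 1" and u: "Linfty_on UNIV u" and l: "has_frac_laplacian \<sigma> u x l"
    and R: "R > 0" and nn: "A \<ge> 0" "\<delta> \<ge> 0" "m \<ge> 0"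
    and touch: "\<And>z. norm z < R \<Longrightarrow> u (x + z) \<le> u x + q \<bullet> z + A * (norm z)\<^sup>2"
    and le: "AE y in lebesgue. u y \<le> u x + \<delta>"
    and E: "E \<in> sets borel" "\<And>y. y \<in> E \<Longrightarrow> R \<le> norm (y - x) \<and> norm (y - x) \<le> S"
    and low: "AE y in lebesgue. y \<in> E \<longrightarrow> u y \<le> u x - m"
    and C1: "\<forall>R>0. integrable lborel
        (\<lambda>z::'a. indicator (ball 0 R) z * ((norm z)\<^sup>2 * riesz_weight \<sigma> z)) \<and>
      (\<integral>z. indicator (ball (0::'a) R) z * ((norm z)\<^sup>2 * riesz_weight \<sigma> z) \<partial>lborel)
        \<le> C1 * R powr (2 - 2 * \<sigma>)"
    and C2: "\<forall>R>0. integrable lborel (\<lambda>z::'a. indicator (- ball 0 R) z * riesz_weight \<sigma> z) \<and>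
      (\<integral>z. indicator (- ball (0::'a) R) z * riesz_weight \<sigma> z \<partial>lborel) \<le> C2 * R powr (- 2 * \<sigma>)"
  shows "frac_lap_const TYPE('a) \<sigma> *
    (m * S powr - (real DIM('a) + 2 * \<sigma>) * measure lborel E
      - A * (C1 * R powr (2 - 2 * \<sigma>)) - \<delta> * (C2 * R powr (- 2 * \<sigma>))) \<le> l"
    (is "?K * ?v \<le> l")
proof -
  let ?d = "real DIM('a) + 2 * \<sigma>"
  let ?near = "\<lambda>z::'a. indicator (ball 0 R) z * ((norm z)\<^sup>2 * riesz_weight \<sigma> z)"
  let ?far = "\<lambda>r (z::'a). indicator (- ball 0 r) z * riesz_weight \<sigma> z"
  have near_int: "integrable lborel ?near" and near_le: "(\<integral>z. ?near z \<partial>lborel) \<le> C1 * R powr (2 - 2 * \<sigma>)"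
    using C1 R by blast+
  have far_int: "integrable lborel (?far r)" if "r > 0" for r using C2 that by blast
  have far_le: "(\<integral>z. ?far R z \<partial>lborel) \<le> C2 * R powr (- 2 * \<sigma>)" using C2 R by blast
  have E_fin: "emeasure lborel E < \<infinity>"
  proof -
    have "E \<subseteq> cball x S" using E(2) by (auto simp: dist_norm norm_minus_commute)
    then have "emeasure lborel E \<le> emeasure lborel (cball x S)" by (intro emeasure_mono) auto
    then show ?thesis using emeasure_lborel_cball_finite le_less_trans by blast
  qed
  have E_int: "integrable lborel (indicator E :: 'a \<Rightarrow> real)"
    using E_fin E(1) by (intro integrable_real_indicator) auto
  have u_meas: "u \<in> borel_measurable lebesgue"
    using u by (simp add: Linfty_on_def lebesgue_on_UNIV_eq)
  obtain B where B: "AE y in lebesgue. \<bar>u y\<bar> \<le> B"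
    using u unfolding Linfty_on_def lebesgue_on_UNIV_eq by blast
  \<comment> \<open>A bound independent of the truncation radius \<eta>, hence inherited by the
    limit.\<close>
  have bound: "?v \<le> frac_lap_trunc \<sigma> u x \<eta>" if \<eta>: "0 < \<eta>" "\<eta> < R" for \<eta>
  proof -
    \<comment> \<open>\<open>F\<close> is the integrand and \<open>G\<close> its minorant.
      \<open>h\<close> is the linear part of the paraboloid on the annulus from \<eta> to
      \<open>R\<close>; the quadratic part is taken over all of \<open>ball 0 R\<close>, which only
      lowers the bound as \<open>A \<ge> 0\<close>.\<close>
    define F where "F y = ?far \<eta> (y - x) * (u x - u y)" for y
    define h where "h z = (if norm z < R then ?far \<eta> z * (q \<bullet> z) else 0)" for z
    define g where "g z = - h z - A * ?near z - \<delta> * ?far R z" for z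
    define G where "G y = g (y - x) + m * S powr - ?d * indicator E y" for y
    have h_meas: "h \<in> borel_measurable borel"
    proof -
      have "h = (\<lambda>z. indicator (ball 0 R) z * (?far \<eta> z * (q \<bullet> z)))"
        by (auto simp: h_def indicator_def)
      moreover have "?far \<eta> \<in> borel_measurable borel"
        using far_int[OF \<eta>(1)] by simp
      ultimately show ?thesis by (auto intro!: borel_measurable_times borel_measurable_indicator)
    qed
    \<comment> \<open>The truncation at \<eta> is what makes the linear part integrable, so that its
      integral vanishes by oddness.\<close>
    have h_int: "integrable lborel h"
    proof (rule Bochner_Integration.integrable_bound)
      show "integrable lborel (\<lambda>z. (norm q * R) * ?far \<eta> z)"
        using far_int[OF \<eta>(1)] by (rule integrable_mult_right)
      have "norm (h z) \<le> norm ((norm q * R) * ?far \<eta> z)" for z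
      proof (cases "norm z < R")
        case True
        have "\<bar>q \<bullet> z\<bar> \<le> norm q * norm z" by (rule Cauchy_Schwarz_ineq2)
        also have "\<dots> \<le> norm q * R" using True by (intro mult_left_mono) auto
        finally have "\<bar>?far \<eta> z\<bar> * \<bar>q \<bullet> z\<bar> \<le> \<bar>?far \<eta> z\<bar> * (norm q * R)"
          by (intro mult_left_mono) auto
        then show ?thesis using True R by (simp add: h_def abs_mult mult_ac)
      qed (simp add: h_def)
      then show "AE z in lborel. norm (h z) \<le> norm ((norm q * R) * ?far \<eta> z)" by simp
    qed (use h_meas in simp)
    have h_zero: "(\<integral>z. h z \<partial>lborel) = 0"
    proof -
      have "h (- z) = - h z" for z by (simp add: h_def indicator_def)
      then have "(\<integral>z. - h z \<partial>lborel) = (\<integral>z. h z \<partial>lborel)"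
        using integral_lborel_uminus[OF h_meas] by simp
      then show ?thesis by simp
    qed
    have g_int: "integrable lborel g"
      unfolding g_def[abs_def] using h_int near_int far_int[OF R] by auto
    have g_val: "(\<integral>z. g z \<partial>lborel) = - A * (\<integral>z. ?near z \<partial>lborel) - \<delta> * (\<integral>z. ?far R z \<partial>lborel)"
    proof -
      have "(\<integral>z. g z \<partial>lborel) = (\<integral>z. - h z \<partial>lborel) - (\<integral>z. A * ?near z \<partial>lborel)
          - (\<integral>z. \<delta> * ?far R z \<partial>lborel)"
        unfolding g_def[abs_def] using h_int near_int far_int[OF R]
        by (subst Bochner_Integration.integral_diff, simp, simp,
            subst Bochner_Integration.integral_diff, simp_all)
      then show ?thesis using h_zero by simp
    qed
    have G_int: "integrable lborel G"
      unfolding G_def[abs_def] using integrable_lborel_shift(1)[OF g_int, of x] E_int by auto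
    have "(\<integral>y. G y \<partial>lebesgue) = (\<integral>y. G y \<partial>lborel)"
      using G_int by (intro integral_completion) simp
    also have "\<dots> = (\<integral>z. g z \<partial>lborel) + m * S powr - ?d * measure lborel E"
      unfolding G_def[abs_def] using integrable_lborel_shift[OF g_int, of x] E_int E(1)
      by (subst Bochner_Integration.integral_add) auto
    finally have "?v \<le> (\<integral>y. G y \<partial>lebesgue)"
      using mult_left_mono[OF near_le nn(1)] mult_left_mono[OF far_le nn(2)] by (simp add: g_val)
    also have "\<dots> \<le> (\<integral>y. F y \<partial>lebesgue)"
    proof (rule integral_mono_AE)
      show "integrable lebesgue G" using G_int by (subst integrable_completion) simp_all
      have far_leb: "integrable lebesgue (\<lambda>y. ?far \<eta> (y - x))"
        using integrable_lborel_shift(1)[OF far_int[OF \<eta>(1)], of x]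
        by (subst integrable_completion) simp_all
      show "integrable lebesgue F"
      proof (rule Bochner_Integration.integrable_bound)
        show "integrable lebesgue (\<lambda>y. (\<bar>u x\<bar> + B) * ?far \<eta> (y - x))"
          using far_leb by (rule integrable_mult_right)
        show "F \<in> borel_measurable lebesgue"
          unfolding F_def[abs_def]
          by (rule borel_measurable_times[OF borel_measurable_integrable[OF far_leb]]) (use u_meas in simp)
        show "AE y in lebesgue. norm (F y) \<le> norm ((\<bar>u x\<bar> + B) * ?far \<eta> (y - x))"
          using B
        proof eventually_elim
          fix y assume y: "\<bar>u y\<bar> \<le> B"
          have "\<bar>?far \<eta> (y - x)\<bar> * \<bar>u x - u y\<bar> \<le> \<bar>?far \<eta> (y - x)\<bar> * \<bar>\<bar>u x\<bar> + B\<bar>"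
            using y by (intro mult_left_mono) auto
          then show "norm (F y) \<le> norm ((\<bar>u x\<bar> + B) * ?far \<eta> (y - x))"
            by (simp only: F_def real_norm_def abs_mult mult.commute)
        qed
      qed
      show "AE y in lebesgue. G y \<le> F y"
        using le low
      proof eventually_elim
        fix y assume le: "u y \<le> u x + \<delta>" and low: "y \<in> E \<longrightarrow> u y \<le> u x - m"
        let ?w = "riesz_weight \<sigma> (y - x)"
        consider "norm (y - x) < \<eta>" | "\<eta> \<le> norm (y - x)" "norm (y - x) < R" | "R \<le> norm (y - x)"
          by linarith
        then show "G y \<le> F y"
        proof cases
          case 1
          then have "y \<notin> E" using E(2)[of y] \<eta> by auto
          \<comment> \<open>Inside the truncation radius \<open>F\<close> vanishes and
            \<open>G\<close> is at most 0.\<close>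
          then show ?thesis using 1 \<eta> nn by (simp add: G_def g_def h_def F_def)
        next
          case 2
          then have "y \<notin> E" using E(2)[of y] by auto
          moreover have "?w * (- (q \<bullet> (y - x)) - A * (norm (y - x))\<^sup>2) \<le> ?w * (u x - u y)"
            using touch[of "y - x"] 2 by (intro mult_left_mono) auto
          ultimately show ?thesis using 2 by (simp add: G_def g_def h_def F_def algebra_simps)
        next
          case 3
          show ?thesis
          proof (cases "y \<in> E")
            case True
            have "S powr - ?d \<le> ?w"
              using E(2)[OF True] R s by (intro riesz_weight_ge) auto
            then have "m * S powr - ?d \<le> ?w * m"
              using nn by (subst mult.commute) (intro mult_right_mono, auto)
            also have "\<dots> \<le> ?w * (u x - u y)" using low True by (intro mult_left_mono) auto
            \<comment> \<open>\<open>G\<close> subtracts the \<delta> term on \<open>E\<close> as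
              well; this only weakens the bound.\<close>
            finally have "m * S powr - ?d - \<delta> * ?w \<le> ?w * (u x - u y)"
              using nn mult_nonneg_nonneg[of \<delta> ?w] by (smt (verit) riesz_weight_nonneg)
            then show ?thesis using 3 \<eta> True by (simp add: G_def g_def h_def F_def)
          next
            case False
            have "?w * (- \<delta>) \<le> ?w * (u x - u y)" using le by (intro mult_left_mono) auto
            then show ?thesis using 3 \<eta> False by (simp add: G_def g_def h_def F_def mult.commute)
          qed
        qed
      qed
    qed
    also have "\<dots> = frac_lap_trunc \<sigma> u x \<eta>"
      unfolding frac_lap_trunc_eq_riesz_weight F_def by (simp add: mult.assoc)
    finally show ?thesis .
  qed
  have "\<forall>\<^sub>F \<eta> in at_right 0. ?K * ?v \<le> ?K * frac_lap_trunc \<sigma> u x \<eta>"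
    using eventually_at_right_real[OF R]
    by eventually_elim (use bound frac_lap_const_pos[OF s, where 'a='a] in \<open>auto intro!: mult_left_mono\<close>)
  then show ?thesis
    using l unfolding has_frac_laplacian_def by (intro tendsto_lowerbound) auto
qed

text \<open>Along each coordinate line \<open>u\<close> minus the paraboloid has a local maximum at
  0, so the second derivative of \<open>u\<close> there is at most \<open>2 * A\<close>; summing
  over the basis gives the bound.\<close>

lemma laplacian_le_of_touching:
  fixes u :: "'a::euclidean_space \<Rightarrow> real"
  assumes "open S" "C2_on S u" "x \<in> S" "R > 0"
    and touch: "\<And>z. norm z < R \<Longrightarrow> u (x + z) \<le> u x + q \<bullet> z + A * (norm z)\<^sup>2"
  shows "laplacian u x \<le> 2 * A * real DIM('a)"
proof -
  obtain G H where G: "\<And>y. y \<in> S \<Longrightarrow> (u has_derivative (\<lambda>v. G y \<bullet> v)) (at y)"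
    and H: "\<And>y. y \<in> S \<Longrightarrow> (G has_derivative blinfun_apply (H y)) (at y)"
    using assms(2) unfolding C2_on_def by blast
  obtain e0 where e0: "e0 > 0" "ball x e0 \<subseteq> S"
    using assms(1,3) open_contains_ball by blast
  define e where "e = min e0 R"
  have e: "e > 0" "e \<le> R" "ball x e \<subseteq> S" using e0 assms(4) by (auto simp: e_def)
  have "deriv (deriv (\<lambda>t. u (x + t *\<^sub>R b))) 0 \<le> 2 * A" if b: "b \<in> Basis" for b
  proof -
    have nb: "norm b = 1" using b by simp
    define f where "f t = u (x + t *\<^sub>R b)" for t
    define f1 where "f1 t = G (x + t *\<^sub>R b) \<bullet> b" for t
    define D where "D = H x b \<bullet> b"
    have inS: "x + t *\<^sub>R b \<in> S" if "\<bar>t\<bar> < e" for t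
      using e that nb by (intro subsetD[OF e(3)]) (simp add: dist_norm)
    have line: "((\<lambda>t. x + t *\<^sub>R b) has_derivative (\<lambda>t. t *\<^sub>R b)) (at t)" for t
      by (auto intro!: derivative_eq_intros)
    have f_der: "(f has_real_derivative f1 t) (at t)" if "\<bar>t\<bar> < e" for t
    proof -
      have "((\<lambda>t. u (x + t *\<^sub>R b)) has_derivative (\<lambda>s. G (x + t *\<^sub>R b) \<bullet> (s *\<^sub>R b))) (at t)"
        by (rule has_derivative_compose[OF line G[OF inS[OF that]]])
      then show ?thesis
        by (simp add: f_def[abs_def] f1_def has_field_derivative_def mult.commute[of _ "G _ \<bullet> b"])
    qed
    have f1_der: "(f1 has_real_derivative D) (at 0)"
    proof -
      have "((\<lambda>t. G (x + t *\<^sub>R b)) has_derivative (\<lambda>s. H (x + 0 *\<^sub>R b) (s *\<^sub>R b))) (at 0)"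
        using e by (intro has_derivative_compose[OF line H[OF inS]]) auto
      then have "((\<lambda>t. G (x + t *\<^sub>R b) \<bullet> b) has_derivative (\<lambda>s. H x (s *\<^sub>R b) \<bullet> b)) (at 0)"
        by (intro has_derivative_inner_left) simp
      then show ?thesis
        by (simp add: f1_def[abs_def] D_def has_field_derivative_def blinfun.scaleR_right mult.commute[of _ "_ \<bullet> b"])
    qed
    \<comment> \<open>The outer \<open>deriv\<close> needs the inner one in a neighbourhood of 0,
      not only at 0.\<close>
    have ev: "\<forall>\<^sub>F t in nhds 0. deriv f t = f1 t"
    proof -
      have "\<forall>\<^sub>F t in nhds 0. t \<in> {-e<..<e}" using e by (intro eventually_nhds_in_open) auto
      then show ?thesis by eventually_elim (auto intro!: DERIV_imp_deriv f_der)
    qed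
    have "deriv (deriv f) 0 = D"
      using deriv_cong_ev[OF ev refl] DERIV_imp_deriv[OF f1_der] by simp
    moreover have "D \<le> 2 * A"
    proof (rule ccontr)
      assume "\<not> D \<le> 2 * A"
      \<comment> \<open>If \<open>D > 2 * A\<close>, then \<open>k1\<close> vanishes at 0 and has
        positive derivative there, so it is positive just to the right. Then \<open>k\<close>
        increases there, against its maximum at 0.\<close>
      define k where "k t = f t - (q \<bullet> b) * t - A * t\<^sup>2" for t
      define k1 where "k1 t = f1 t - q \<bullet> b - 2 * A * t" for t
      have k_der: "(k has_real_derivative k1 t) (at t)" if "\<bar>t\<bar> < e" for t
        unfolding k_def[abs_def] k1_def using f_der[OF that]
        by (auto intro!: derivative_eq_intros)
      have k1_der: "(k1 has_real_derivative D - 2 * A) (at 0)"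
        unfolding k1_def[abs_def] using f1_der by (auto intro!: derivative_eq_intros)
      have k_max: "k t \<le> k 0" if "\<bar>t\<bar> < e" for t
        using touch[of "t *\<^sub>R b"] that e nb by (simp add: k_def f_def mult.commute)
      have "k1 0 = 0"
        using e k_max by (intro DERIV_local_max[OF k_der[of 0], of e]) auto
      moreover obtain d where d: "d > 0" "\<And>h. 0 < h \<Longrightarrow> h < d \<Longrightarrow> k1 0 < k1 (0 + h)"
        using DERIV_pos_inc_right[OF k1_der] \<open>\<not> D \<le> 2 * A\<close> by auto
      ultimately have k1_pos: "k1 h > 0" if "0 < h" "h < d" for h using that by (metis add_0)
      define t where "t = min d e / 2"
      have t: "0 < t" "t < d" "t < e" using d e by (auto simp: t_def min_def)
      have "k 0 < k t"
      proof (rule DERIV_pos_imp_increasing_open[OF t(1)])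
        show "\<exists>y. (k has_real_derivative y) (at h) \<and> 0 < y" if "0 < h" "h < t" for h
          using k_der[of h] k1_pos[of h] that t by (intro exI[of _ "k1 h"]) auto
        show "continuous_on {0..t} k"
        proof (intro continuous_at_imp_continuous_on ballI)
          show "isCont k h" if "h \<in> {0..t}" for h
            using k_der[of h] that t by (intro DERIV_isCont[of k "k1 h"]) auto
        qed
      qed
      then show False using k_max[of t] t by simp
    qed
    ultimately show ?thesis by (simp add: f_def[abs_def])
  qed
  then have "laplacian u x \<le> (\<Sum>b\<in>(Basis::'a set). 2 * A)"
    unfolding laplacian_def by (rule sum_mono)
  then show ?thesis by (simp add: mult.commute)
qed

section \<open>Penalisation near the boundary\<close>

text \<open>Gradient and Hessian are bounded on the compact ball. The mean value inequality for
  \<open>f\<close> gives the Lipschitz bound; applied to \<open>G\<close> and then to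
  \<open>f\<close> minus its linear part at \<open>x\<close>, it gives the quadratic one.\<close>

lemma C2_on_UNIV_taylor:
  fixes f :: "'a::euclidean_space \<Rightarrow> real"
  assumes "C2_on UNIV f"
  shows "\<exists>G L K. 0 \<le> L \<and> 0 \<le> K \<and> (\<forall>x\<in>cball 0 B. \<forall>y\<in>cball 0 B.
    \<bar>f y - f x\<bar> \<le> L * norm (y - x) \<and>
    \<bar>f y - f x - G x \<bullet> (y - x)\<bar> \<le> K * (norm (y - x))\<^sup>2)"
proof -
  obtain G H where G: "\<And>x. (f has_derivative (\<lambda>v. G x \<bullet> v)) (at x)"
    and H: "\<And>x. (G has_derivative blinfun_apply (H x)) (at x)" and H_cont: "continuous_on UNIV H"
    using assms unfolding C2_on_def by blast
  have "compact (H ` cball 0 B)"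
    by (intro compact_continuous_image continuous_on_subset[OF H_cont]) auto
  then obtain K where K: "K > 0" "\<And>x. norm x \<le> B \<Longrightarrow> norm (H x) \<le> K"
    using compact_imp_bounded bounded_pos by (metis (no_types, lifting) image_eqI mem_cball_0)
  have "continuous_on UNIV G"
    using H by (intro continuous_at_imp_continuous_on ballI has_derivative_continuous) auto
  then have "compact (G ` cball 0 B)"
    by (intro compact_continuous_image) (auto intro: continuous_on_subset)
  then obtain L where L: "L > 0" "\<And>x. norm x \<le> B \<Longrightarrow> norm (G x) \<le> L"
    using compact_imp_bounded bounded_pos by (metis (no_types, lifting) image_eqI mem_cball_0)
  have inner_onorm: "onorm (\<lambda>v. w \<bullet> v) \<le> b" if "norm w \<le> b" for w :: 'a and b
  proof (rule onorm_bound)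
    show "0 \<le> b" using that norm_ge_zero order_trans by blast
    show "norm (w \<bullet> v) \<le> b * norm v" for v
      using Cauchy_Schwarz_ineq2[of w v] mult_right_mono[OF that, of "norm v"] by simp
  qed
  have "\<bar>f y - f x\<bar> \<le> L * norm (y - x)" if "norm x \<le> B" "norm y \<le> B" for x y
    using differentiable_bound[of "cball 0 B" f "\<lambda>x v. G x \<bullet> v" L y x] that L(2)
    by (auto intro: has_derivative_at_withinI[OF G] inner_onorm)
  moreover have "\<bar>f y - f x - G x \<bullet> (y - x)\<bar> \<le> K * (norm (y - x))\<^sup>2"
    if xy: "norm x \<le> B" "norm y \<le> B" for x y
  proof -
    have G_lip: "norm (G w - G x) \<le> K * norm (w - x)" if "norm w \<le> B" for w
      using differentiable_bound[of "cball 0 B" G "\<lambda>x. blinfun_apply (H x)" K w x] that xy K(2)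
      by (auto intro: has_derivative_at_withinI[OF H] simp: norm_blinfun.rep_eq[symmetric])
    \<comment> \<open>On the segment from \<open>x\<close> to \<open>y\<close> the gradient of the
      difference is \<open>G w - G x\<close>, of norm at most
      \<open>K * norm (y - x)\<close>.\<close>
    have "norm ((f y - G x \<bullet> y) - (f x - G x \<bullet> x)) \<le> (K * norm (y - x)) * norm (y - x)"
    proof (rule differentiable_bound[of "closed_segment x y" _ "\<lambda>w v. (G w - G x) \<bullet> v"])
      fix w assume w: "w \<in> closed_segment x y"
      show "((\<lambda>y. f y - G x \<bullet> y) has_derivative (\<lambda>v. (G w - G x) \<bullet> v)) (at w within closed_segment x y)"
        by (auto intro!: derivative_eq_intros has_derivative_at_withinI[OF G] simp: inner_diff_left)
      have "w \<in> cball 0 B"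
        using w xy closed_segment_subset[of x "cball 0 B" y] by (auto simp: convex_cball)
      then have "norm (G w - G x) \<le> K * norm (w - x)" by (intro G_lip) simp
      also have "\<dots> \<le> K * norm (y - x)"
        using segment_bound1[OF w] K(1) by (intro mult_left_mono) (auto simp: norm_minus_commute)
      finally show "onorm (\<lambda>v. (G w - G x) \<bullet> v) \<le> K * norm (y - x)" by (rule inner_onorm)
    qed auto
    then show ?thesis by (simp add: inner_diff_right power2_eq_square algebra_simps)
  qed
  ultimately show ?thesis
    using L(1) K(1) by (intro exI[of _ G] exI[of _ L] exI[of _ K]) simp
qed

text \<open>\<rho> is linear minus \<open>\<gamma>\<close> composed with the orthogonal projection
  \<open>P\<close>. As \<open>P\<close> is linear and does not increase norms, the bounds for
  \<gamma> carry over with the same \<open>K\<close>.\<close>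

lemma epigraph_function_taylor:
  fixes \<gamma> :: "'a::euclidean_space \<Rightarrow> real" and \<rho> :: "'a \<Rightarrow> real"
  assumes \<gamma>: "C2_on UNIV \<gamma>" and \<nu>: "norm \<nu> = 1"
    and \<rho>: "\<And>x. \<rho> x = x \<bullet> \<nu> - \<gamma> (x - (x \<bullet> \<nu>) *\<^sub>R \<nu>)"
  shows "\<exists>g L K. 1 \<le> L \<and> 0 \<le> K \<and> (\<forall>x\<in>cball 0 B. \<forall>y\<in>cball 0 B.
    \<bar>\<rho> y - \<rho> x\<bar> \<le> L * norm (y - x) \<and>
    \<rho> x + g x \<bullet> (y - x) - K * (norm (y - x))\<^sup>2 \<le> \<rho> y)"
proof -
  obtain G L K where LK: "L \<ge> 0" "K \<ge> 0"
    and tay: "\<forall>x\<in>cball 0 B. \<forall>y\<in>cball 0 B. \<bar>\<gamma> y - \<gamma> x\<bar> \<le> L * norm (y - x) \<and>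
      \<bar>\<gamma> y - \<gamma> x - G x \<bullet> (y - x)\<bar> \<le> K * (norm (y - x))\<^sup>2"
    using C2_on_UNIV_taylor[OF \<gamma>, of B] by (elim exE conjE)
  define P where "P x = x - (x \<bullet> \<nu>) *\<^sub>R \<nu>" for x :: 'a
  have \<nu>1: "\<nu> \<bullet> \<nu> = 1" using \<nu> by (simp add: dot_square_norm)
  have P_norm: "norm (P x) \<le> norm x" for x
  proof -
    have "P x \<bullet> P x = x \<bullet> x - (x \<bullet> \<nu>)\<^sup>2"
      using \<nu>1 by (simp add: P_def inner_diff_left inner_diff_right inner_commute power2_eq_square)
    then show ?thesis by (simp add: norm_le)
  qed
  have P_diff: "P y - P x = P (y - x)" for x y
    by (simp add: P_def inner_diff_left scaleR_left_diff_distrib)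
  \<comment> \<open>The gradient of \<rho>: the outer \<open>P\<close> comes from moving the
    self-adjoint projection across the inner product.\<close>
  define g where "g x = \<nu> - P (G (P x))" for x
  have g: "g x \<bullet> v = v \<bullet> \<nu> - G (P x) \<bullet> P v" for x v
    by (simp add: g_def P_def inner_diff_left inner_diff_right inner_commute)
  have PB: "P x \<in> cball 0 B" if "x \<in> cball 0 B" for x
    using P_norm[of x] that by simp
  have "\<bar>\<rho> y - \<rho> x\<bar> \<le> (L + 1) * norm (y - x) \<and>
      \<rho> x + g x \<bullet> (y - x) - K * (norm (y - x))\<^sup>2 \<le> \<rho> y"
    if xy: "x \<in> cball 0 B" "y \<in> cball 0 B" for x y
  proof
    have \<rho>_diff: "\<rho> y - \<rho> x = (y - x) \<bullet> \<nu> - (\<gamma> (P y) - \<gamma> (P x))"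
      by (simp add: \<rho> P_def inner_diff_left)
    have "\<bar>(y - x) \<bullet> \<nu>\<bar> \<le> norm (y - x)" using Cauchy_Schwarz_ineq2[of "y - x" \<nu>] \<nu> by simp
    moreover have "\<bar>\<gamma> (P y) - \<gamma> (P x)\<bar> \<le> L * norm (y - x)"
      using tay PB[OF xy(1)] PB[OF xy(2)] mult_left_mono[OF P_norm[of "y - x"] LK(1)]
      by (fastforce simp: P_diff)
    ultimately show "\<bar>\<rho> y - \<rho> x\<bar> \<le> (L + 1) * norm (y - x)"
      unfolding \<rho>_diff by (simp add: algebra_simps)
    have "K * (norm (P (y - x)))\<^sup>2 \<le> K * (norm (y - x))\<^sup>2"
      using P_norm LK(2) by (intro mult_left_mono power_mono) auto
    then show "\<rho> x + g x \<bullet> (y - x) - K * (norm (y - x))\<^sup>2 \<le> \<rho> y"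
      using tay PB[OF xy(1)] PB[OF xy(2)] \<rho>_diff by (fastforce simp: g P_diff)
  qed
  then show ?thesis
    using LK by (intro exI[of _ g] exI[of _ "L + 1"] exI[of _ K]) simp
qed

text \<open>Expand \<open>ln (1 + t)\<close> at the relative increment
  \<open>t = (b - a) / a\<close>. The hypothesis \<open>low\<close> bounds the linear term from
  below; the Lipschitz bound gives \<open>\<bar>t\<bar> \<le> 1/2\<close> and controls the error
  \<open>2 * t\<^sup>2\<close>.\<close>

lemma ln_diff_le_quadratic:
  fixes a b :: real
  assumes a: "a > 0" and lip: "\<bar>b - a\<bar> \<le> L * w" "L * w \<le> a / 2" and low: "a + c - K * w\<^sup>2 \<le> b"
  shows "ln a - ln b \<le> - (c / a) + (K / a + 2 * L\<^sup>2 / a\<^sup>2) * w\<^sup>2"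
proof -
  define t where "t = (b - a) / a"
  have b: "b > 0" using assms by linarith
  have abs_t: "\<bar>t\<bar> \<le> L * w / a" using lip(1) a by (simp add: t_def divide_right_mono)
  moreover have "L * w / a \<le> 1/2" using lip(2) a by (simp add: field_simps)
  ultimately have "\<bar>t\<bar> \<le> 1/2" by linarith
  then have "\<bar>ln (1 + t) - t\<bar> \<le> 2 * t\<^sup>2" by (rule abs_ln_one_plus_x_minus_x_bound)
  moreover have "ln (1 + t) = ln b - ln a"
  proof -
    have "1 + t = b / a" using a by (simp add: t_def field_simps)
    then show ?thesis using a b by (simp add: ln_div)
  qed
  moreover have "t\<^sup>2 \<le> (L * w / a)\<^sup>2"
    using power_mono[OF abs_t, of 2] by simp
  moreover have "(c - K * w\<^sup>2) / a \<le> t" using low a by (simp add: t_def divide_right_mono)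
  ultimately have "ln a - ln b \<le> - ((c - K * w\<^sup>2) / a) + 2 * (L * w / a)\<^sup>2" by linarith
  also have "\<dots> = - (c / a) + (K / a + 2 * L\<^sup>2 / a\<^sup>2) * w\<^sup>2"
    by (simp add: power_mult_distrib power_divide diff_divide_distrib algebra_simps)
  finally show ?thesis .
qed

text \<open>The logarithm drives the penalised function down as \<rho> tends to 0, so maximising
  over the compact part \<open>\<tau> \<le> \<rho>\<close> is enough. An interior competitor
  \<open>x1\<close> near \<open>x0\<close> shows that the maximum is at least
  \<open>M - \<delta>\<close>.\<close>

lemma log_penalised_maximum:
  fixes u \<rho> :: "'a::euclidean_space \<Rightarrow> real"
  assumes u: "continuous_on (closure \<Omega>) u" "\<And>x. x \<in> closure \<Omega> \<Longrightarrow> u x \<le> M" "u x0 = M"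
    and x0: "x0 \<in> closure \<Omega>" and r: "r > 0" and \<rho>: "continuous_on UNIV \<rho>"
    and iff: "\<And>y. y \<in> cball x0 r \<Longrightarrow> y \<in> \<Omega> \<longleftrightarrow> 0 < \<rho> y"
    and \<rho>1: "\<And>y. y \<in> cball x0 r \<Longrightarrow> \<rho> y \<le> 1" and pos: "\<delta> > 0" "\<epsilon>0 > 0"
  shows "\<exists>\<epsilon> x. 0 < \<epsilon> \<and> \<epsilon> \<le> \<epsilon>0 \<and> x \<in> \<Omega> \<and> x \<in> cball x0 r \<and> M - \<delta> \<le> u x - (norm (x - x0))\<^sup>2 \<and>
    (\<forall>y\<in>\<Omega> \<inter> cball x0 r.
      u y + \<epsilon> * ln (\<rho> y) - (norm (y - x0))\<^sup>2 \<le> u x + \<epsilon> * ln (\<rho> x) - (norm (x - x0))\<^sup>2)"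
proof -
  have "continuous_on (closure \<Omega>) (\<lambda>y. u y - (norm (y - x0))\<^sup>2)"
    using u(1) by (intro continuous_intros)
  then obtain e where e: "e > 0" "\<And>y. y \<in> closure \<Omega> \<Longrightarrow> dist y x0 < e \<Longrightarrow>
      dist (u y - (norm (y - x0))\<^sup>2) (u x0 - (norm (x0 - x0))\<^sup>2) < \<delta> / 2"
    unfolding continuous_on_iff using x0 pos(1) half_gt_zero by metis
  obtain x1 where x1: "x1 \<in> \<Omega>" "dist x1 x0 < min e r"
    using x0 e(1) r unfolding closure_approachable by (metis min_less_iff_conj)
  have x1_val: "M - \<delta> / 2 < u x1 - (norm (x1 - x0))\<^sup>2"
  proof -
    have "dist (u x1 - (norm (x1 - x0))\<^sup>2) (u x0 - (norm (x0 - x0))\<^sup>2) < \<delta> / 2"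
      using x1 closure_subset[of \<Omega>] by (intro e(2)) auto
    then have "\<bar>u x1 - (norm (x1 - x0))\<^sup>2 - M\<bar> < \<delta> / 2" using u(3) by (simp add: dist_real_def)
    then show ?thesis by linarith
  qed
  have x1_ball: "x1 \<in> cball x0 r" using x1 by (simp add: dist_commute)
  then have \<rho>x1: "0 < \<rho> x1" "\<rho> x1 \<le> 1" using iff x1(1) \<rho>1 by auto
  \<comment> \<open>Makes the penalty at \<open>x1\<close> cost at most \<open>\<delta> / 2\<close>;
    the summand 1 keeps the denominator positive when \<open>\<rho> x1 = 1\<close>.\<close>
  define \<epsilon> where "\<epsilon> = min \<epsilon>0 (\<delta> / (2 * (1 - ln (\<rho> x1))))"
  have ln1: "ln (\<rho> x1) \<le> 0" using \<rho>x1 by simp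
  have \<epsilon>: "0 < \<epsilon>" "\<epsilon> \<le> \<epsilon>0" using pos ln1 by (auto simp: \<epsilon>_def)
  have "\<epsilon> * (1 - ln (\<rho> x1)) \<le> \<delta> / (2 * (1 - ln (\<rho> x1))) * (1 - ln (\<rho> x1))"
    using ln1 by (intro mult_right_mono) (auto simp: \<epsilon>_def)
  also have "\<dots> = \<delta> / 2"
  proof -
    have cancel: "\<delta> / (2 * v) * v = \<delta> / 2" if "v \<noteq> 0" for v :: real using that by simp
    show ?thesis by (rule cancel) (use ln1 in simp)
  qed
  finally have \<epsilon>ln: "- (\<delta> / 2) \<le> \<epsilon> * ln (\<rho> x1)" using \<epsilon>(1) by (simp add: algebra_simps)
  define \<Phi> where "\<Phi> y = u y + \<epsilon> * ln (\<rho> y) - (norm (y - x0))\<^sup>2" for y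
  have \<Phi>x1: "M - \<delta> \<le> \<Phi> x1" using x1_val \<epsilon>ln by (simp add: \<Phi>_def)
  \<comment> \<open>Where \<open>\<rho> < \<tau>\<close> the penalty exceeds
    \<open>2 * \<delta>\<close>, so the penalised value is below \<open>M - 2 * \<delta>\<close> and
    cannot compete with \<open>x1\<close>.\<close>
  define \<tau> where "\<tau> = exp (- 2 * \<delta> / \<epsilon>)"
  have \<tau>: "\<tau> > 0" "\<epsilon> * ln \<tau> = - 2 * \<delta>" using \<epsilon> by (auto simp: \<tau>_def)
  define D where "D = closure \<Omega> \<inter> cball x0 r \<inter> {y. \<tau> \<le> \<rho> y}"
  have "closed {y. \<tau> \<le> \<rho> y}" using \<rho> by (intro closed_Collect_le) auto
  then have "compact D"
    unfolding D_def by (intro compact_Int_closed closed_Int_compact) auto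
  moreover have "x1 \<in> D"
  proof -
    have "\<epsilon> * ln \<tau> \<le> \<epsilon> * ln (\<rho> x1)" using \<tau>(2) \<epsilon>ln pos(1) by linarith
    then have "\<tau> \<le> \<rho> x1" using \<epsilon>(1) \<tau>(1) \<rho>x1(1) by simp
    then show ?thesis using x1(1) closure_subset[of \<Omega>] x1_ball by (auto simp: D_def)
  qed
  moreover have "continuous_on D \<Phi>"
    unfolding \<Phi>_def[abs_def] using \<tau>(1)
    by (intro continuous_intros continuous_on_subset[OF u(1)] continuous_on_subset[OF \<rho>])
      (auto simp: D_def)
  ultimately obtain x where x: "x \<in> D" "\<And>y. y \<in> D \<Longrightarrow> \<Phi> y \<le> \<Phi> x"
    using continuous_attains_sup[of D \<Phi>] by blast
  have xc: "x \<in> cball x0 r" "0 < \<rho> x" "\<tau> \<le> \<rho> x" using x(1) \<tau>(1) by (auto simp: D_def)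
  have \<Phi>x: "M - \<delta> \<le> \<Phi> x" using \<Phi>x1 x(2)[OF \<open>x1 \<in> D\<close>] by linarith
  show ?thesis
  proof (intro exI[of _ \<epsilon>] exI[of _ x] conjI ballI \<epsilon>)
    show "x \<in> \<Omega>" using iff xc by blast
    show "x \<in> cball x0 r" by (rule xc)
    \<comment> \<open>\<open>\<rho> \<le> 1\<close> makes the logarithmic term nonpositive, so
      dropping it keeps the lower bound.\<close>
    have "\<epsilon> * ln (\<rho> x) \<le> 0"
      using \<rho>1[OF xc(1)] xc(2) \<epsilon>(1) by (simp add: mult_le_0_iff)
    then show "M - \<delta> \<le> u x - (norm (x - x0))\<^sup>2" using \<Phi>x by (simp add: \<Phi>_def)
    fix y assume "y \<in> \<Omega> \<inter> cball x0 r"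
    then have y: "y \<in> \<Omega>" "y \<in> cball x0 r" by auto
    have y_cl: "y \<in> closure \<Omega>" using y closure_subset by blast
    have "\<Phi> y \<le> \<Phi> x"
    proof (cases "\<tau> \<le> \<rho> y")
      case True
      then show ?thesis using x(2) y y_cl by (simp add: D_def)
    next
      case False
      have "\<rho> y > 0" using iff y by blast
      then have "\<epsilon> * ln (\<rho> y) \<le> \<epsilon> * ln \<tau>" using False \<epsilon>(1) \<tau>(1) by simp
      then have "\<Phi> y \<le> M - 2 * \<delta>"
        using u(2)[OF y_cl] \<tau>(2) zero_le_power2[of "norm (y - x0)"] unfolding \<Phi>_def by linarith
      then show ?thesis using \<Phi>x pos(1) by linarith
    qed
    then show "u y + \<epsilon> * ln (\<rho> y) - (norm (y - x0))\<^sup>2 \<le> u x + \<epsilon> * ln (\<rho> x) - (norm (x - x0))\<^sup>2"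
      by (simp add: \<Phi>_def)
  qed
qed

section \<open>Exclusion of positive interior and boundary maxima\<close>

lemma no_positive_interior_maximum:
  fixes u :: "'a::euclidean_space \<Rightarrow> real"
  assumes s: "0 < \<sigma>" "\<sigma> < 1" and \<Omega>: "open \<Omega>" "bounded \<Omega>"
    and u: "Linfty_on UNIV u" "C2_on \<Omega> u" and ext: "AE y in lebesgue. y \<notin> closure \<Omega> \<longrightarrow> u y \<le> 0"
    and x: "x \<in> \<Omega>" "u x > 0" and max: "\<And>y. y \<in> closure \<Omega> \<Longrightarrow> u y \<le> u x"
    and l: "has_frac_laplacian \<sigma> u x l"
  shows "laplacian u x \<le> 0" "0 < l"
proof -
  obtain R where R: "R > 0" "ball x R \<subseteq> \<Omega>" using \<Omega>(1) x(1) open_contains_ball by blast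
  have touch: "u (x + z) \<le> u x + 0 \<bullet> z + 0 * (norm z)\<^sup>2" if "norm z < R" for z
  proof -
    have "x + z \<in> ball x R" using that by (simp add: dist_norm)
    then have "x + z \<in> closure \<Omega>" using R(2) closure_subset by blast
    then show ?thesis using max by simp
  qed
  show "laplacian u x \<le> 0"
    using laplacian_le_of_touching[OF \<Omega>(1) u(2) x(1) R(1) touch] by simp
  obtain C1 where C1: "\<forall>R>0. integrable lborel
        (\<lambda>z::'a. indicator (ball 0 R) z * ((norm z)\<^sup>2 * riesz_weight \<sigma> z)) \<and>
      (\<integral>z. indicator (ball (0::'a) R) z * ((norm z)\<^sup>2 * riesz_weight \<sigma> z) \<partial>lborel)
        \<le> C1 * R powr (2 - 2 * \<sigma>)"
    using riesz_weight_second_moment[OF s, where 'a='a] by blast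
  obtain C2 where C2: "\<forall>R>0. integrable lborel (\<lambda>z::'a. indicator (- ball 0 R) z * riesz_weight \<sigma> z) \<and>
      (\<integral>z. indicator (- ball (0::'a) R) z * riesz_weight \<sigma> z \<partial>lborel) \<le> C2 * R powr (- 2 * \<sigma>)"
    using riesz_weight_tail[OF s(1), where 'a='a] by blast
  obtain B where B: "B > 0" "\<And>y. y \<in> closure \<Omega> \<Longrightarrow> norm y \<le> B"
    using bounded_closure[OF \<Omega>(2)] bounded_pos by metis
  obtain e :: 'a where e: "norm e = 1" using vector_choose_size[of 1] by auto
  \<comment> \<open>Points of \<open>E\<close> are more than \<open>t - 1\<close> from
    \<open>x\<close>, so their norm exceeds \<open>B\<close> and they avoid the closure of \<Omega>.
    There \<open>u\<close> drops by at least the full \<open>u x\<close>, while the touching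
    paraboloid is constant and both error terms vanish.\<close>
  define t where "t = R + B + norm x + 2"
  define E where "E = ball (x + t *\<^sub>R e) 1"
  have t: "t > 0" using R B by (simp add: t_def add_pos_nonneg)
  have E: "R \<le> norm (y - x) \<and> norm (y - x) \<le> t + 1 \<and> y \<notin> closure \<Omega>" if "y \<in> E" for y
  proof -
    have "norm (y - (x + t *\<^sub>R e)) < 1" using that by (simp add: E_def dist_norm norm_minus_commute)
    moreover have "y - x = (y - (x + t *\<^sub>R e)) + t *\<^sub>R e" by simp
    moreover have "norm (t *\<^sub>R e) = t" using e t by simp
    ultimately have "t - 1 < norm (y - x)" "norm (y - x) < t + 1"
      using norm_triangle_ineq[of "y - (x + t *\<^sub>R e)" "t *\<^sub>R e"]
        norm_diff_ineq[of "t *\<^sub>R e" "y - (x + t *\<^sub>R e)"] by (simp_all add: add.commute)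
    moreover have "norm (y - x) \<le> norm y + norm x" by (rule norm_triangle_ineq4)
    ultimately show ?thesis
      using B(1) B(2)[of y] R(1) norm_ge_zero[of x] unfolding t_def by linarith
  qed
  have "frac_lap_const TYPE('a) \<sigma> *
    (u x * (t + 1) powr - (real DIM('a) + 2 * \<sigma>) * measure lborel E
      - 0 * (C1 * R powr (2 - 2 * \<sigma>)) - 0 * (C2 * R powr (- 2 * \<sigma>))) \<le> l"
  proof (rule has_frac_laplacian_lower_bound[OF s u(1) l R(1) _ _ _ touch _ _ _ _ C1 C2])
    show "AE y in lebesgue. u y \<le> u x + 0"
      using ext by eventually_elim (use max x(2) in fastforce)
    show "AE y in lebesgue. y \<in> E \<longrightarrow> u y \<le> u x - u x"
      using ext by eventually_elim (use E in auto)
  qed (use E x(2) in \<open>auto simp: E_def\<close>)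
  moreover have "measure lborel E > 0"
    by (simp add: E_def content_ball)
  ultimately show "0 < l"
    using frac_lap_const_pos[OF s, where 'a='a] x(2) t
    by (smt (verit) mult_pos_pos mult_zero_left powr_gt_zero)
qed

text \<open>
  At the penalised maximum \<open>x\<close>, all three lengths (the radius of the touching paraboloid, the radius
  of the exterior ball \<open>E\<close>, and its distance to \<open>x\<close>) are multiples of \<open>a = \<rho> x\<close>, so every term of
  the lower bound scales like \<open>a powr (- 2 * \<sigma>)\<close>; \<open>c0\<close> is the main coefficient, and \<open>\<theta>\<close>, \<open>\<delta>\<close>, \<open>\<epsilon>0\<close>
  make the two error coefficients at most \<open>c0 / 4\<close> each.
\<close>

lemma no_positive_boundary_maximum:
  fixes u \<gamma> :: "'a::euclidean_space \<Rightarrow> real"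
  assumes s: "0 < \<sigma>" "\<sigma> < 1" and p: "1 \<le> p" "1 \<le> \<sigma> * p" and \<Omega>: "open \<Omega>"
    and u: "Linfty_on UNIV u" "C2_on \<Omega> u" "continuous_on (closure \<Omega>) u"
    and ext: "AE y in lebesgue. y \<notin> closure \<Omega> \<longrightarrow> u y \<le> 0"
    and eq: "\<And>x. x \<in> \<Omega> \<Longrightarrow>
      \<exists>l. has_frac_laplacian \<sigma> u x l \<and> - laplacian u x + \<bar>l\<bar> powr (p - 1) * l = 0"
    and x0: "x0 \<in> frontier \<Omega>" "0 < u x0" and max: "\<And>y. y \<in> closure \<Omega> \<Longrightarrow> u y \<le> u x0"
    and graph: "r > 0" "norm \<nu> = 1" "C2_on UNIV \<gamma>"
      "\<And>x. x \<in> ball x0 r \<Longrightarrow> x \<in> \<Omega> \<longleftrightarrow> x \<bullet> \<nu> > \<gamma> (x - (x \<bullet> \<nu>) *\<^sub>R \<nu>)"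
  shows False
proof -
  let ?N = "real DIM('a)"
  let ?d = "?N + 2 * \<sigma>"
  let ?Kc = "frac_lap_const TYPE('a) \<sigma>"
  have Kc: "?Kc > 0" by (rule frac_lap_const_pos[OF s])
  define M where "M = u x0"
  have M: "M > 0" using x0 by (simp add: M_def)
  define \<rho> where "\<rho> y = y \<bullet> \<nu> - \<gamma> (y - (y \<bullet> \<nu>) *\<^sub>R \<nu>)" for y
  have iff: "y \<in> \<Omega> \<longleftrightarrow> 0 < \<rho> y" if "y \<in> ball x0 r" for y
    using graph(4)[OF that] by (simp add: \<rho>_def)
  have \<rho>_cont: "continuous_on UNIV \<rho>"
  proof -
    obtain G where "\<And>x. (\<gamma> has_derivative (\<lambda>v. G x \<bullet> v)) (at x)"
      using graph(3) unfolding C2_on_def by blast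
    then have cont: "continuous_on UNIV \<gamma>"
      by (intro continuous_at_imp_continuous_on ballI) (rule has_derivative_continuous)
    have "continuous_on UNIV (\<lambda>y. \<gamma> (y - (y \<bullet> \<nu>) *\<^sub>R \<nu>))"
      by (rule continuous_on_compose2[OF cont]) (auto intro!: continuous_intros)
    then show ?thesis
      unfolding \<rho>_def[abs_def] by (intro continuous_intros)
  qed
  obtain g L K where LK: "1 \<le> L" "0 \<le> K" and taylor:
    "\<forall>x\<in>cball 0 (norm x0 + r). \<forall>y\<in>cball 0 (norm x0 + r).
      \<bar>\<rho> y - \<rho> x\<bar> \<le> L * norm (y - x) \<and>
      \<rho> x + g x \<bullet> (y - x) - K * (norm (y - x))\<^sup>2 \<le> \<rho> y"
    using epigraph_function_taylor[OF graph(3,2) \<rho>_def, of "norm x0 + r"] by (elim exE conjE)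
  have in_cball: "y \<in> cball 0 (norm x0 + r)" if "y \<in> ball x0 r" for y
    using that norm_triangle_sub[of y x0] by (simp add: dist_norm norm_minus_commute)
  have lip: "\<bar>\<rho> y - \<rho> x\<bar> \<le> L * norm (y - x)" if "x \<in> ball x0 r" "y \<in> ball x0 r" for x y
    using taylor in_cball that by blast
  have low: "\<rho> x + g x \<bullet> (y - x) - K * (norm (y - x))\<^sup>2 \<le> \<rho> y"
    if "x \<in> ball x0 r" "y \<in> ball x0 r" for x y
    using taylor in_cball that by blast
  obtain C1 where C1: "C1 > 0" "\<forall>R>0. integrable lborel
        (\<lambda>z::'a. indicator (ball 0 R) z * ((norm z)\<^sup>2 * riesz_weight \<sigma> z)) \<and>
      (\<integral>z. indicator (ball (0::'a) R) z * ((norm z)\<^sup>2 * riesz_weight \<sigma> z) \<partial>lborel)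
        \<le> C1 * R powr (2 - 2 * \<sigma>)"
    using riesz_weight_second_moment[OF s, where 'a='a] by blast
  obtain C2 where C2: "C2 > 0"
    "\<forall>R>0. integrable lborel (\<lambda>z::'a. indicator (- ball 0 R) z * riesz_weight \<sigma> z) \<and>
      (\<integral>z. indicator (- ball (0::'a) R) z * riesz_weight \<sigma> z \<partial>lborel) \<le> C2 * R powr (- 2 * \<sigma>)"
    using riesz_weight_tail[OF s(1), where 'a='a] by blast
  \<comment> \<open>\<open>r / 2\<close> keeps the closed ball inside the chart;
    \<open>1 / L\<close> forces \<open>\<rho> \<le> 1\<close> on it because
    \<open>\<rho> x0 \<le> 0\<close>.\<close>
  define r1 where "r1 = min (r / 2) (1 / L)"
  have r1: "r1 > 0" "r1 < r" "L * r1 \<le> 1"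
    using graph(1) LK by (auto simp: r1_def min_def field_simps)
  \<comment> \<open>Over a distance \<open>\<kappa> * a\<close> the function \<rho> varies by at
    most \<open>a / 2\<close>: it stays positive about \<open>x\<close> and negative about the
    exterior point where it equals \<open>- a\<close>.\<close>
  define \<kappa> where "\<kappa> = 1 / (2 * L)"
  have \<kappa>: "\<kappa> > 0" "\<kappa> \<le> 1/2" "L * \<kappa> = 1/2" using LK by (auto simp: \<kappa>_def field_simps)
  define V where "V = unit_ball_vol ?N"
  \<comment> \<open>Comes from a drop \<open>M / 2\<close> on a ball of radius
    \<open>\<kappa> * a\<close> lying within distance \<open>3 * a\<close> of
    \<open>x\<close>.\<close>
  define c0 where "c0 = M / 2 * 3 powr - ?d * (V * \<kappa> ^ DIM('a))"
  define D1 where "D1 = C1 * \<kappa> powr (2 - 2 * \<sigma>)"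
  define D2 where "D2 = C2 * \<kappa> powr (- 2 * \<sigma>)"
  have c0: "c0 > 0" and D1: "D1 > 0" and D2: "D2 > 0"
    using M \<kappa>(1) C1(1) C2(1) by (simp_all add: c0_def D1_def D2_def V_def)
  define c1 where "c1 = ?Kc * (c0 / 2)"
  have c1: "c1 > 0" using Kc c0 by (simp add: c1_def)
  \<comment> \<open>\<theta> will bound \<open>A * a\<^sup>2\<close>. The second entry serves the
    final contradiction, where \<open>2 * ?N * \<theta>\<close> is at most half of
    \<open>c1 powr p\<close>.\<close>
  define \<theta> where "\<theta> = min (c0 / (4 * D1)) (c1 powr p / (4 * ?N))"
  have \<theta>: "\<theta> > 0" "\<theta> * D1 \<le> c0 / 4" "\<theta> * (4 * ?N) \<le> c1 powr p"
  proof -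
    show "\<theta> > 0" using c0 D1 c1 by (simp add: \<theta>_def)
    have "\<theta> \<le> c0 / (4 * D1)" "\<theta> \<le> c1 powr p / (4 * ?N)" by (simp_all add: \<theta>_def)
    then show "\<theta> * D1 \<le> c0 / 4" "\<theta> * (4 * ?N) \<le> c1 powr p"
      using D1 by (simp_all add: pos_le_divide_eq mult_ac)
  qed
  \<comment> \<open>In order: the far error, the bound \<open>a\<^sup>2 \<le> \<theta> / 2\<close>,
    the drop of at least \<open>M / 2\<close> outside, and \<open>x\<close> so close to
    \<open>x0\<close> that all points used lie in the chart.\<close>
  define \<delta> where "\<delta> = min (min (c0 / (4 * D2)) (\<theta> / (2 * L\<^sup>2))) (min (M / 2) ((r1 / (2 * (1 + 3 * L)))\<^sup>2))"
  have L2: "L\<^sup>2 > 0" using LK by simp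
  have \<delta>: "\<delta> > 0" "\<delta> * D2 \<le> c0 / 4" "L\<^sup>2 * \<delta> \<le> \<theta> / 2" "\<delta> \<le> M / 2"
    "\<delta> \<le> (r1 / (2 * (1 + 3 * L)))\<^sup>2"
  proof -
    show "\<delta> > 0" using c0 D2 \<theta> M r1 LK by (simp add: \<delta>_def)
    have "\<delta> \<le> c0 / (4 * D2)" "\<delta> \<le> \<theta> / (2 * L\<^sup>2)" by (simp_all add: \<delta>_def)
    then show "\<delta> * D2 \<le> c0 / 4" "L\<^sup>2 * \<delta> \<le> \<theta> / 2"
      using D2 L2 by (simp_all add: pos_le_divide_eq mult_ac)
  qed (simp_all add: \<delta>_def)
  define \<epsilon>0 where "\<epsilon>0 = \<theta> / (2 * (K + 2 * L\<^sup>2))"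
  have \<epsilon>0: "\<epsilon>0 > 0" using \<theta> LK L2 by (simp add: \<epsilon>0_def add_nonneg_pos)
  have x0_cl: "x0 \<in> closure \<Omega>" using x0 by (simp add: frontier_def)
  have x0_ball: "x0 \<in> ball x0 r" using graph(1) by simp
  have \<rho>x0: "\<rho> x0 \<le> 0"
  proof -
    have "x0 \<notin> \<Omega>" using x0 \<Omega> by (simp add: frontier_def interior_open)
    then show ?thesis using iff[OF x0_ball] by simp
  qed
  have r1_ball: "y \<in> ball x0 r" if "y \<in> cball x0 r1" for y using that r1 by simp
  have \<rho>_le: "\<rho> y \<le> L * norm (y - x0)" if "y \<in> ball x0 r" for y
    using lip[OF x0_ball that] \<rho>x0 by linarith
  have "\<exists>\<epsilon> x. 0 < \<epsilon> \<and> \<epsilon> \<le> \<epsilon>0 \<and> x \<in> \<Omega> \<and> x \<in> cball x0 r1 \<and> M - \<delta> \<le> u x - (norm (x - x0))\<^sup>2 \<and>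
    (\<forall>y\<in>\<Omega> \<inter> cball x0 r1.
      u y + \<epsilon> * ln (\<rho> y) - (norm (y - x0))\<^sup>2 \<le> u x + \<epsilon> * ln (\<rho> x) - (norm (x - x0))\<^sup>2)"
  proof (rule log_penalised_maximum[OF u(3) _ _ x0_cl r1(1) \<rho>_cont _ _ \<delta>(1) \<epsilon>0])
    show "y \<in> \<Omega> \<longleftrightarrow> 0 < \<rho> y" if "y \<in> cball x0 r1" for y using iff r1_ball that by blast
    show "\<rho> y \<le> 1" if y: "y \<in> cball x0 r1" for y
    proof -
      have "L * norm (y - x0) \<le> L * r1"
        using y LK by (intro mult_left_mono) (auto simp: dist_norm norm_minus_commute)
      then show ?thesis using \<rho>_le[OF r1_ball[OF y]] r1(3) by linarith
    qed
  qed (use max in \<open>auto simp: M_def\<close>)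
  then obtain \<epsilon> x where \<epsilon>: "0 < \<epsilon>" "\<epsilon> \<le> \<epsilon>0" and x: "x \<in> \<Omega>" "x \<in> cball x0 r1"
    and ux: "M - \<delta> \<le> u x - (norm (x - x0))\<^sup>2"
    and pen: "\<And>y. y \<in> \<Omega> \<inter> cball x0 r1 \<Longrightarrow>
      u y + \<epsilon> * ln (\<rho> y) - (norm (y - x0))\<^sup>2 \<le> u x + \<epsilon> * ln (\<rho> x) - (norm (x - x0))\<^sup>2"
    by (elim exE conjE) blast
  have xb: "x \<in> ball x0 r" using r1_ball x(2) by blast
  define w where "w = norm (x - x0)"
  have w0: "w \<ge> 0" by (simp add: w_def)
  have ux_le: "u x \<le> M" using max x(1) closure_subset by (auto simp: M_def)
  have w2: "w\<^sup>2 \<le> \<delta>" using ux ux_le by (simp add: w_def)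
  have ux_ge: "M - \<delta> \<le> u x" using ux zero_le_power2[of "norm (x - x0)"] by linarith
  \<comment> \<open>Points of \<open>E\<close> are within \<open>3 * a \<le> 3 * L * w\<close> of
    \<open>x\<close>, hence within \<open>(1 + 3 * L) * w\<close> of \<open>x0\<close>.\<close>
  have w_small: "(1 + 3 * L) * w < r1"
  proof -
    have "w\<^sup>2 \<le> (r1 / (2 * (1 + 3 * L)))\<^sup>2" using w2 \<delta>(5) by linarith
    then have "w \<le> r1 / (2 * (1 + 3 * L))" using r1 LK by (rule_tac power2_le_imp_le) auto
    then have "(1 + 3 * L) * w \<le> r1 / 2" using LK by (simp add: field_simps)
    then show ?thesis using r1 by linarith
  qed
  define a where "a = \<rho> x"
  have a: "a > 0" using iff[OF xb] x(1) by (simp add: a_def)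
  have a_le: "a \<le> L * w" using \<rho>_le[OF xb] by (simp add: a_def w_def)
  have Lw: "w \<le> L * w" using LK w0 by (simp add: mult_le_cancel_right1)
  have "L * w \<le> L * r1" using w_small Lw w0 LK by (intro mult_left_mono) (auto simp: algebra_simps)
  then have a1: "a \<le> 1" using a_le r1(3) by linarith
  have a2: "a\<^sup>2 \<le> \<theta> / 2"
  proof -
    have "a\<^sup>2 \<le> (L * w)\<^sup>2" using a a_le by (intro power_mono) auto
    also have "\<dots> \<le> L\<^sup>2 * \<delta>" using w2 by (simp add: power_mult_distrib mult_left_mono)
    finally show ?thesis using \<delta>(3) by linarith
  qed
  \<comment> \<open>The quadratic coefficient of the logarithmic penalty times \<epsilon>, plus 1
    from \<open>(norm (y - x0))\<^sup>2\<close>.\<close>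
  define A where "A = \<epsilon> * (K / a + 2 * L\<^sup>2 / a\<^sup>2) + 1"
  have A0: "A \<ge> 0" using \<epsilon> LK a by (simp add: A_def)
  have Aa: "A * a\<^sup>2 \<le> \<theta>"
  proof -
    have "A * a\<^sup>2 = \<epsilon> * (K * a + 2 * L\<^sup>2) + a\<^sup>2"
      using a by (simp add: A_def field_simps power2_eq_square)
    also have "\<epsilon> * (K * a + 2 * L\<^sup>2) \<le> \<epsilon>0 * (K + 2 * L\<^sup>2)"
      using \<epsilon> a a1 LK by (intro mult_mono add_mono) (auto simp: mult_left_le)
    also have "\<epsilon>0 * (K + 2 * L\<^sup>2) = \<theta> / 2"
    proof -
      have cancel: "\<theta> / (2 * v) * v = \<theta> / 2" if "v \<noteq> 0" for v :: real using that by simp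
      have "K + 2 * L\<^sup>2 > 0" using LK L2 by linarith
      then show ?thesis unfolding \<epsilon>0_def by (intro cancel) simp
    qed
    finally show ?thesis using a2 by linarith
  qed
  define R where "R = \<kappa> * a"
  have R: "R > 0" "R \<le> a / 2" "L * R = a / 2"
  proof -
    show "R > 0" using \<kappa> a by (simp add: R_def)
    show "R \<le> a / 2" using \<kappa> a mult_right_mono[of \<kappa> "1/2" a] by (simp add: R_def)
    show "L * R = a / 2" using \<kappa>(3) by (simp add: R_def mult.assoc[symmetric])
  qed
  \<comment> \<open>The gradient forced on \<open>u\<close> at the maximum point: minus that of
    \<open>\<epsilon> * ln \<rho>\<close> plus that of the squared distance to
    \<open>x0\<close>.\<close>
  define q where "q = (- (\<epsilon> / a)) *\<^sub>R g x + 2 *\<^sub>R (x - x0)"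
  have touch: "u (x + z) \<le> u x + q \<bullet> z + A * (norm z)\<^sup>2" if z: "norm z < R" for z
  proof -
    have "norm (x + z - x0) \<le> w + norm z"
      using norm_triangle_ineq[of "x - x0" z] by (simp add: w_def algebra_simps)
    also have "\<dots> \<le> r1" using z R(2) a_le w_small w0 Lw by (simp add: algebra_simps)
    finally have zc: "x + z \<in> cball x0 r1" by (simp add: dist_norm norm_minus_commute)
    have zb: "x + z \<in> ball x0 r" by (rule r1_ball[OF zc])
    have Lz: "L * norm z \<le> a / 2"
      using mult_left_mono[of "norm z" R L] z LK R(3) by simp
    have lip_z: "\<bar>\<rho> (x + z) - a\<bar> \<le> L * norm z" using lip[OF xb zb] by (simp add: a_def)
    then have "\<rho> (x + z) > 0" using Lz a by linarith
    then have "x + z \<in> \<Omega>" using iff[OF zb] by simp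
    then have "u (x + z) \<le> u x + \<epsilon> * (ln a - ln (\<rho> (x + z)))
        + ((norm (x + z - x0))\<^sup>2 - (norm (x - x0))\<^sup>2)"
      using pen[of "x + z"] zc by (simp add: a_def algebra_simps)
    also have "(norm (x + z - x0))\<^sup>2 - (norm (x - x0))\<^sup>2 = 2 * ((x - x0) \<bullet> z) + (norm z)\<^sup>2"
      by (simp add: power2_norm_eq_inner inner_diff_left inner_diff_right inner_add_left inner_add_right
          inner_commute algebra_simps)
    also have "\<epsilon> * (ln a - ln (\<rho> (x + z)))
        \<le> \<epsilon> * (- ((g x \<bullet> z) / a) + (K / a + 2 * L\<^sup>2 / a\<^sup>2) * (norm z)\<^sup>2)"
    proof (rule mult_left_mono)
      show "ln a - ln (\<rho> (x + z)) \<le> - ((g x \<bullet> z) / a) + (K / a + 2 * L\<^sup>2 / a\<^sup>2) * (norm z)\<^sup>2"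
        using low[OF xb zb] by (intro ln_diff_le_quadratic[OF a lip_z Lz]) (simp add: a_def)
    qed (use \<epsilon> in simp)
    also have "u x + \<epsilon> * (- ((g x \<bullet> z) / a) + (K / a + 2 * L\<^sup>2 / a\<^sup>2) * (norm z)\<^sup>2)
        + (2 * ((x - x0) \<bullet> z) + (norm z)\<^sup>2) = u x + q \<bullet> z + A * (norm z)\<^sup>2"
      by (simp add: q_def A_def inner_add_left algebra_simps)
    finally show ?thesis by simp
  qed
  obtain l where l: "has_frac_laplacian \<sigma> u x l" and lap: "laplacian u x = \<bar>l\<bar> powr (p - 1) * l"
    using eq[OF x(1)] by auto
  \<comment> \<open>The centre lies \<open>2 * a\<close> below \<open>x\<close> along \<nu>. This
    move leaves the argument of \<gamma> unchanged, so \<rho> falls from \<open>a\<close> to exactly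
    \<open>- a\<close>.\<close>
  define E where "E = ball (x - (2 * a) *\<^sub>R \<nu>) R"
  have E: "R \<le> norm (y - x) \<and> norm (y - x) \<le> 3 * a \<and> y \<notin> closure \<Omega>" if y: "y \<in> E" for y
  proof -
    define c where "c = x - (2 * a) *\<^sub>R \<nu>"
    have yc: "norm (y - c) < R" using y by (simp add: E_def c_def dist_norm norm_minus_commute)
    have nc: "norm (c - x) = 2 * a" using a graph(2) by (simp add: c_def)
    have up: "norm (y - x) \<le> norm (y - c) + norm (c - x)"
      using norm_triangle_ineq[of "y - c" "c - x"] by simp
    have dn: "norm (c - x) \<le> norm (y - c) + norm (y - x)"
      using norm_triangle_ineq[of "c - y" "y - x"] by (simp add: norm_minus_commute)
    have near: "v \<in> ball x0 r" if "norm (v - x) \<le> 3 * a" for v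
    proof -
      have "norm (v - x0) \<le> norm (v - x) + w"
        using norm_triangle_ineq[of "v - x" "x - x0"] by (simp add: w_def)
      then have "norm (v - x0) < r"
        using that a_le w_small r1 by (simp add: algebra_simps)
      then show ?thesis by (simp add: dist_norm norm_minus_commute)
    qed
    have yb: "y \<in> ball x0 r" and cb: "c \<in> ball x0 r"
      using near[of y] near[of c] up nc yc R a by simp_all
    have "\<rho> c = - a"
    proof -
      have "\<nu> \<bullet> \<nu> = 1" using graph(2) by (simp add: dot_square_norm)
      then have "c \<bullet> \<nu> = x \<bullet> \<nu> - 2 * a" "c - (c \<bullet> \<nu>) *\<^sub>R \<nu> = x - (x \<bullet> \<nu>) *\<^sub>R \<nu>"
        by (simp_all add: c_def inner_diff_left algebra_simps)
      then show ?thesis by (simp add: \<rho>_def a_def)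
    qed
    moreover have "L * norm (y - c) \<le> a / 2"
      using mult_left_mono[of "norm (y - c)" R L] yc LK R(3) by simp
    ultimately have "\<rho> y < 0" using lip[OF cb yb] a by linarith
    \<comment> \<open>Openness is needed because \<open>y\<close> has to avoid the closure of
      \<Omega>, not just \<Omega>.\<close>
    moreover have "open {v \<in> ball x0 r. \<rho> v < 0}"
    proof -
      have "open {v. \<rho> v < 0}" using \<rho>_cont by (intro open_Collect_less) auto
      then have "open (ball x0 r \<inter> {v. \<rho> v < 0})" by (intro open_Int) auto
      moreover have "ball x0 r \<inter> {v. \<rho> v < 0} = {v \<in> ball x0 r. \<rho> v < 0}" by blast
      ultimately show ?thesis by simp
    qed
    moreover have "{v \<in> ball x0 r. \<rho> v < 0} \<inter> \<Omega> = {}" using iff by force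
    ultimately have "y \<notin> closure \<Omega>"
      using yb open_Int_closure_eq_empty[of "{v \<in> ball x0 r. \<rho> v < 0}" \<Omega>] by blast
    then show ?thesis using up dn nc yc R by simp
  qed
  have "?Kc * (M / 2 * (3 * a) powr - ?d * measure lborel E
      - A * (C1 * R powr (2 - 2 * \<sigma>)) - \<delta> * (C2 * R powr (- 2 * \<sigma>))) \<le> l"
  proof (rule has_frac_laplacian_lower_bound[OF s u(1) l R(1) A0 _ _ touch _ _ _ _ C1(2) C2(2)])
    show "AE y in lebesgue. u y \<le> u x + \<delta>"
      using ext
    proof eventually_elim
      fix y assume "y \<notin> closure \<Omega> \<longrightarrow> u y \<le> 0"
      then show "u y \<le> u x + \<delta>"
        using max[of y] M ux_ge by (cases "y \<in> closure \<Omega>") (auto simp: M_def)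
    qed
    show "AE y in lebesgue. y \<in> E \<longrightarrow> u y \<le> u x - M / 2"
      using ext by eventually_elim (use E ux_ge \<delta>(4) in force)
  qed (use E M \<delta> in \<open>auto simp: E_def\<close>)
  also have "M / 2 * (3 * a) powr - ?d * measure lborel E
      - A * (C1 * R powr (2 - 2 * \<sigma>)) - \<delta> * (C2 * R powr (- 2 * \<sigma>))
      = a powr (- 2 * \<sigma>) * (c0 - A * a\<^sup>2 * D1 - \<delta> * D2)"
  proof -
    have "measure lborel E = V * (\<kappa> ^ DIM('a) * a powr ?N)"
      using R(1) a by (simp add: E_def content_ball V_def R_def power_mult_distrib powr_realpow)
    moreover have "(3 * a) powr - ?d = 3 powr - ?d * a powr - ?d"
      using a by (subst powr_mult) auto
    moreover have "a powr - ?d * a powr ?N = a powr (- 2 * \<sigma>)"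
      by (simp add: powr_add[symmetric])
    ultimately have "M / 2 * (3 * a) powr - ?d * measure lborel E = a powr (- 2 * \<sigma>) * c0"
      by (simp add: c0_def mult_ac)
    moreover have "R powr (2 - 2 * \<sigma>) = \<kappa> powr (2 - 2 * \<sigma>) * (a\<^sup>2 * a powr (- 2 * \<sigma>))"
    proof -
      have "a powr (2 - 2 * \<sigma>) = a powr 2 * a powr (- 2 * \<sigma>)" by (simp add: powr_add[symmetric])
      also have "a powr 2 = a\<^sup>2" using a by simp
      finally show ?thesis using a \<kappa> by (simp add: R_def powr_mult)
    qed
    moreover have "R powr (- 2 * \<sigma>) = \<kappa> powr (- 2 * \<sigma>) * a powr (- 2 * \<sigma>)"
      using a \<kappa> by (simp add: R_def powr_mult)
    ultimately show ?thesis by (simp add: D1_def D2_def algebra_simps)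
  qed
  finally have l_ge: "?Kc * (a powr (- 2 * \<sigma>) * (c0 - A * a\<^sup>2 * D1 - \<delta> * D2)) \<le> l" .
  have "A * a\<^sup>2 * D1 \<le> \<theta> * D1" using Aa D1 by (intro mult_right_mono) auto
  then have "c0 / 2 \<le> c0 - A * a\<^sup>2 * D1 - \<delta> * D2" using \<theta>(2) \<delta>(2) by linarith
  then have "?Kc * (a powr (- 2 * \<sigma>) * (c0 / 2)) \<le> ?Kc * (a powr (- 2 * \<sigma>) * (c0 - A * a\<^sup>2 * D1 - \<delta> * D2))"
    using Kc by (intro mult_left_mono) auto
  then have l_ge': "c1 * a powr (- 2 * \<sigma>) \<le> l" using l_ge by (simp add: c1_def mult_ac)
  moreover have l_base: "c1 * a powr (- 2 * \<sigma>) > 0" using c1 a by simp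
  ultimately have l_pos: "l > 0" by linarith
  have "c1 powr p * (1 / a\<^sup>2) \<le> c1 powr p * a powr (- 2 * \<sigma> * p)"
  proof (rule mult_left_mono)
    \<comment> \<open>Here \<open>1 \<le> \<sigma> * p\<close> enters: as \<open>a \<le> 1\<close>,
      the more negative exponent gives the larger power.\<close>
    have "a powr (- 2) \<le> a powr (- 2 * \<sigma> * p)"
      using a a1 p by (intro powr_mono') (auto simp: algebra_simps)
    then show "1 / a\<^sup>2 \<le> a powr (- 2 * \<sigma> * p)"
      using a by (simp add: powr_minus_divide)
  qed simp
  also have "\<dots> = (c1 * a powr (- 2 * \<sigma>)) powr p"
    using c1 by (simp add: powr_mult powr_powr)
  also have "\<dots> \<le> l powr p" using l_ge' l_base p by (intro powr_mono2) auto
  also have "\<dots> = laplacian u x"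
  proof -
    have "l powr p = l powr (p - 1) * l powr 1" by (simp only: powr_add[symmetric]) simp
    then show ?thesis using l_pos lap by simp
  qed
  also have "\<dots> \<le> 2 * A * ?N"
    by (rule laplacian_le_of_touching[OF \<Omega> u(2) x(1) R(1) touch])
  \<comment> \<open>Clearing \<open>a\<^sup>2\<close> leaves
    \<open>A * a\<^sup>2 \<le> \<theta>\<close>, so the positive number \<open>c1 powr p\<close> is
    at most half of itself.\<close>
  finally have "c1 powr p \<le> 2 * A * ?N * a\<^sup>2" using a by (simp add: divide_le_eq)
  also have "\<dots> = (2 * ?N) * (A * a\<^sup>2)" by simp
  also have "\<dots> \<le> (2 * ?N) * \<theta>" using Aa by (intro mult_left_mono) auto
  also have "\<dots> \<le> c1 powr p / 2" using \<theta>(3) by (simp add: mult_ac)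
  finally show False using c1 by simp
qed

theorem theorem1p3:
  fixes \<Omega> :: "'a::euclidean_space set"
    and \<sigma> p :: real
    and g h :: "'a \<Rightarrow> real"
  assumes "bounded_C2_domain \<Omega>"
    and "0 < \<sigma>" and "\<sigma> < 1" and "1 \<le> p"
    and "continuous_on (frontier \<Omega>) g"
    and "Linfty_on (- closure \<Omega>) h"
    and "\<exists>x\<in>frontier \<Omega>. g x > 0"
    and "AE x in lebesgue_on (- closure \<Omega>). h x \<le> 0"
    and "\<sigma> * p \<ge> 1"
  shows "\<nexists>u :: 'a \<Rightarrow> real.
           Linfty_on UNIV u \<and> C2_on \<Omega> u \<and> continuous_on (closure \<Omega>) u \<and>
           solves_mixed_problem \<Omega> \<sigma> p g h u"
proof
  assume "\<exists>u :: 'a \<Rightarrow> real.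
           Linfty_on UNIV u \<and> C2_on \<Omega> u \<and> continuous_on (closure \<Omega>) u \<and>
           solves_mixed_problem \<Omega> \<sigma> p g h u"
  then obtain u :: "'a \<Rightarrow> real" where u: "Linfty_on UNIV u" "C2_on \<Omega> u" "continuous_on (closure \<Omega>) u"
    and sol: "solves_mixed_problem \<Omega> \<sigma> p g h u" by blast
  have eq: "\<exists>l. has_frac_laplacian \<sigma> u x l \<and> - laplacian u x + \<bar>l\<bar> powr (p - 1) * l = 0"
    if "x \<in> \<Omega>" for x
    using sol that unfolding solves_mixed_problem_def by blast
  have bd: "u x = g x" if "x \<in> frontier \<Omega>" for x
    using sol that unfolding solves_mixed_problem_def by blast
  have "AE x in lebesgue_on (- closure \<Omega>). u x = h x"
    using sol unfolding solves_mixed_problem_def by blast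
  with assms(8) have "AE x in lebesgue_on (- closure \<Omega>). u x \<le> 0"
    by eventually_elim simp
  then have ext: "AE y in lebesgue. y \<notin> closure \<Omega> \<longrightarrow> u y \<le> 0"
    by (simp add: AE_restrict_space_iff)
  have \<Omega>: "open \<Omega>" "bounded \<Omega>" "C2_boundary \<Omega>"
    using assms(1) unfolding bounded_C2_domain_def by blast+
  obtain z where z: "z \<in> frontier \<Omega>" "g z > 0" using assms(7) by blast
  then have z_cl: "z \<in> closure \<Omega>" by (simp add: frontier_def)
  have "compact (closure \<Omega>)" using \<Omega>(2) by (simp add: compact_closure)
  then have "\<exists>x\<in>closure \<Omega>. \<forall>y\<in>closure \<Omega>. u y \<le> u x"
    using z_cl u(3) by (intro continuous_attains_sup) auto
  then obtain x0 where x0: "x0 \<in> closure \<Omega>" and max: "\<And>y. y \<in> closure \<Omega> \<Longrightarrow> u y \<le> u x0"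
    by blast
  have pos: "u x0 > 0" using max[OF z_cl] bd[OF z(1)] z(2) by simp
  show False
  proof (cases "x0 \<in> \<Omega>")
    case True
    obtain l where l: "has_frac_laplacian \<sigma> u x0 l"
      and eq0: "- laplacian u x0 + \<bar>l\<bar> powr (p - 1) * l = 0"
      using eq[OF True] by blast
    have "laplacian u x0 \<le> 0" "0 < l"
      by (rule no_positive_interior_maximum[OF assms(2,3) \<Omega>(1,2) u(1,2) ext True pos max l]; assumption)+
    \<comment> \<open>Both terms of the equation are nonnegative at \<open>x0\<close> and the
      nonlocal one is strictly positive.\<close>
    moreover from \<open>0 < l\<close> have "\<bar>l\<bar> powr (p - 1) * l > 0" by simp
    ultimately show False using eq0 by linarith
  next
    case False
    then have fr: "x0 \<in> frontier \<Omega>" using x0 \<Omega>(1) by (simp add: frontier_def interior_open)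
    then obtain r \<nu> \<gamma> where graph: "r > 0" "norm \<nu> = 1" "C2_on UNIV \<gamma>"
        "\<forall>x\<in>ball x0 r. x \<in> \<Omega> \<longleftrightarrow> x \<bullet> \<nu> > \<gamma> (x - (x \<bullet> \<nu>) *\<^sub>R \<nu>)"
      using \<Omega>(3) unfolding C2_boundary_def by blast
    show False
      by (rule no_positive_boundary_maximum[OF assms(2,3,4,9) \<Omega>(1) u ext eq fr pos max graph(1-3)])
        (use graph(4) in auto)
  qed
qed

end
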